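(* Let $D,f,g,r,B$ be as in the context, with $D$ having Lipschitz constant $\beta\in(0,1)$ satisfying $\beta^2<\frac{1}{3+2\sqrt2}$. Assume that there is $L>0$ such that $$\langle x_1-x_2,f(x_1,y,t,i)-f(x_2,y,t,i)\rangle\le L|x_1-x_2|^2\quad\text{for all }x_1,x_2,y\in\mathbb{R}^d,\ t\ge0,\ i\in S,$$ and that there are constants $C_1>C_2>0$ with $$C_1>\frac{3+2\sqrt2}{1-(3+2\sqrt2)\beta^2}\,C_2$$ such that $$2\langle x-D(y,i),f(x,y,t,i)\rangle+|g(x,y,t,i)|^2\le-C_1|x|^2+C_2|y|^2\quad\text{for all }x,y\in\mathbb{R}^d,\ t\ge0,\ i\in S.$$ Let $\frac12<\theta\le1$, and let the step size be $\Delta=\tau/n$ with $n\in\mathbb{N}$ and $L\theta\Delta<1$ (so that the scheme is well defined). Then the $\theta$-EM approximation $(X_k)_{k\ge-n}$, defined by $X_j=\xi(j\Delta)$ for $j=-n,\dots,0$ and, for $k\ge0$, $$\begin{aligned}X_{k+1}-D(X_{k+1-n},r((k+1)\Delta))&=X_k-D(X_{k-n},r(k\Delta))+\big[(1-\theta)f(X_k,X_{k-n},k\Delta,r(k\Delta))\\&\quad+\theta f(X_{k+1},X_{k+1-n},(k+1)\Delta,r((k+1)\Delta))\big]\Delta+g(X_k,X_{k-n},k\Delta,r(k\Delta))\Delta B_k,\end{aligned}$$ where $\Delta B_k=B_{(k+1)\Delta}-B_{k\Delta}$, is mean square and almost surely exponentially stable; that is, for all initial data $\xi,i_0$ as in the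 context, $$\limsup_{k\to\infty}\frac{\log\mathbb{E}|X_k|^2}{k\Delta}<0,$$ and there is a constant $\kappa>0$ such that $$\limsup_{k\to\infty}\frac{1}{k\Delta}\log|X_k|\le-\kappa\quad\text{almost surely}.$$
   Context: Setting. $(\Omega,\mathscr{F},P)$ is a probability space with a complete filtration $(\mathscr{F}_t)_{t\ge0}$; $d,m\in\mathbb{N}$ and $\tau>0$ are fixed. $|\cdot|$ is the Euclidean norm on $\mathbb{R}^d$ (and the Hilbert-Schmidt norm for matrices such as $g$), $\langle\cdot,\cdot\rangle$ the inner product. $r(t)$, $t\ge0$, is a right-continuous $(\mathscr{F}_t)$-adapted Markov chain with values in the finite set $S=\{1,\dots,N\}$ and generator $\Gamma=(\gamma_{ij})_{N\times N}$: $P(r(t+\delta)=j\mid r(t)=i)=\gamma_{ij}\delta+o(\delta)$ for $i\ne j$, where $\gamma_{ij}\ge0$ for $i\neq j$ and $\gamma_{ii}=-\sum_{j\ne i}\gamma_{ij}$. $(B_t)_{t\ge0}$ is an $m$-dimensional standard $(\mathscr{F}_t)$-Brownian motion independent of $r$. The initial datum $\xi=\{\xi(s):s\in[-\tau,0]\}$ is a bounded, $\mathscr{F}_0$-measurable, $C([-\tau,0];\mathbb{R}^d)$-valued random variable, and $r(0)=i_0\in S$. Coefficients and standing assumptions. $D:\mathbb{R}^d\times S\to\mathbb{R}^d$, $f:\mathbb{R}^d\times\mathbb{R}^d\times\mathbb{R}_+\times S\to\mathbb{R}^d$, $g:\mathbb{R}^d\times\mathbb{R}^d\times\mathbb{R}_+\times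 S\to\mathbb{R}^{d\times m}$ are Borel measurable and satisfy: - local Lipschitz condition: for each $R>0$ there is $L_R>0$ with $|f(x,y,t,i)-f(\bar x,\bar y,t,i)|\vee|g(x,y,t,i)-g(\bar x,\bar y,t,i)|\le L_R(|x-\bar x|+|y-\bar y|)$ for all $(t,i)\in\mathbb{R}_+\times S$ and $|x|\vee|y|\vee|\bar x|\vee|\bar y|\le R$; - there is $0<\beta<1$ with $|D(x,i)-D(y,i)|\le\beta|x-y|$ for all $x,y\in\mathbb{R}^d$, $i\in S$ (this fixes $\beta$); - $D(0,i)=0$, $f(0,0,t,i)=0$, $g(0,0,t,i)=0$ for all $(t,i)\in\mathbb{R}_+\times S$. The $\theta$-EM scheme approximates the equation $d[X(t)-D(X(t-\tau),r(t))]=f(X(t),X(t-\tau),t,r(t))\,dt+g(X(t),X(t-\tau),t,r(t))\,dB_t$ with initial data $\xi$, $i_0$. Under the one-sided Lipschitz condition on $f$ with constant $L$, the semi-implicit scheme is well defined (each $X_{k+1}$ is uniquely determined) whenever $L\theta\Delta<1$. *)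

theory Defs
  imports "HOL-Probability.Probability" "HOL-Library.Landau_Symbols"
begin

text \<open>
  Time is \<^typ>\<open>real\<close> and only its nonnegative part is used. The state space
  is \<open>{1..N}\<close>. Vectors in \<open>\<real>\<^sup>d\<close> have type \<open>real ^ 'd\<close> and \<open>d \<times> m\<close>
  matrices have type \<open>real ^ 'm ^ 'd\<close>, whose library norm is the Hilbert-Schmidt norm.
\<close>

text \<open>
  Completeness is that of the filtered space: every subset of a \<open>P\<close>-null event belongs to
  \<open>F 0\<close> (so \<open>M\<close> itself is complete).
\<close>

definition complete_filtration :: "'a measure \<Rightarrow> (real \<Rightarrow> 'a measure) \<Rightarrow> bool" where
  "complete_filtration M F \<longleftrightarrow>
     (\<forall>t\<ge>0. subalgebra M (F t)) \<and>
     (\<forall>s t. 0 \<le> s \<and> s \<le> t \<longrightarrow> sets (F s) \<subseteq> sets (F t)) \<and>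
     (\<forall>A\<in>null_sets M. \<forall>A'. A' \<subseteq> A \<longrightarrow> A' \<in> sets (F 0))"

definition generator_matrix :: "nat \<Rightarrow> (nat \<Rightarrow> nat \<Rightarrow> real) \<Rightarrow> bool" where
  "generator_matrix N \<Gamma> \<longleftrightarrow>
     (\<forall>i\<in>{1..N}. \<forall>j\<in>{1..N}. i \<noteq> j \<longrightarrow> 0 \<le> \<Gamma> i j) \<and>
     (\<forall>i\<in>{1..N}. \<Gamma> i i = - (\<Sum>j\<in>{1..N} - {i}. \<Gamma> i j))"

text \<open>
  The third and fourth conjuncts are the Markov property (with respect to the past of \<open>r\<close>
  itself, hence implied by the one with respect to \<open>F\<close>) and time-homogeneity; the last one
  is \<open>P(r(t+\<delta>) = j | r(t) = i) = \<Gamma>\<^sub>i\<^sub>j \<delta> + o(\<delta>)\<close>. Elementary conditional probabilities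
  are only considered given events of positive probability. Right-continuity refers to the
  discrete topology of \<^typ>\<open>nat\<close>.
\<close>

definition markov_chain ::
  "'a measure \<Rightarrow> (real \<Rightarrow> 'a measure) \<Rightarrow> nat \<Rightarrow> (nat \<Rightarrow> nat \<Rightarrow> real) \<Rightarrow> (real \<Rightarrow> 'a \<Rightarrow> nat) \<Rightarrow> bool" where
  "markov_chain M F N \<Gamma> r \<longleftrightarrow>
     (\<forall>t\<ge>0. r t \<in> F t \<rightarrow>\<^sub>M count_space {1..N}) \<and>
     (AE \<omega> in M. \<forall>t\<ge>0. continuous (at_right t) (\<lambda>s. r s \<omega>)) \<and>
     (\<forall>s\<ge>0. \<forall>u\<ge>0. \<forall>J h. \<forall>i\<in>{1..N}. \<forall>j\<in>{1..N}.
        finite J \<and> J \<subseteq> {0..s} \<and> \<P>(\<omega> in M. r s \<omega> = i \<and> (\<forall>v\<in>J. r v \<omega> = h v)) > 0 \<longrightarrow>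
          \<P>(\<omega> in M. r (s + u) \<omega> = j \<bar> r s \<omega> = i \<and> (\<forall>v\<in>J. r v \<omega> = h v))
          = \<P>(\<omega> in M. r (s + u) \<omega> = j \<bar> r s \<omega> = i)) \<and>
     (\<forall>s\<ge>0. \<forall>t\<ge>0. \<forall>u\<ge>0. \<forall>i\<in>{1..N}. \<forall>j\<in>{1..N}.
        \<P>(\<omega> in M. r s \<omega> = i) > 0 \<and> \<P>(\<omega> in M. r t \<omega> = i) > 0 \<longrightarrow>
          \<P>(\<omega> in M. r (s + u) \<omega> = j \<bar> r s \<omega> = i)
          = \<P>(\<omega> in M. r (t + u) \<omega> = j \<bar> r t \<omega> = i)) \<and>
     (\<forall>t\<ge>0. \<forall>i\<in>{1..N}. \<forall>j\<in>{1..N}.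
        i \<noteq> j \<and> \<P>(\<omega> in M. r t \<omega> = i) > 0 \<longrightarrow>
          (\<lambda>\<delta>. \<P>(\<omega> in M. r (t + \<delta>) \<omega> = j \<bar> r t \<omega> = i) - \<Gamma> i j * \<delta>)
          \<in> o[at_right 0](\<lambda>\<delta>. \<delta>))"

text \<open>
  Standard Brownian motion relative to \<open>F\<close>: the increment over \<open>[s, t]\<close> is independent of
  \<open>F s\<close> and has independent \<open>N(0, t - s)\<close> components.
\<close>

definition brownian_motion ::
  "'a measure \<Rightarrow> (real \<Rightarrow> 'a measure) \<Rightarrow> (real \<Rightarrow> 'a \<Rightarrow> real ^ 'm) \<Rightarrow> bool" where
  "brownian_motion M F B \<longleftrightarrow>
     (\<forall>t\<ge>0. B t \<in> borel_measurable (F t)) \<and>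
     (AE \<omega> in M. B 0 \<omega> = 0) \<and>
     (AE \<omega> in M. continuous_on {0..} (\<lambda>t. B t \<omega>)) \<and>
     (\<forall>s t. 0 \<le> s \<and> s < t \<longrightarrow>
        prob_space.indep_set M (sets (F s))
          {(\<lambda>\<omega>. B t \<omega> - B s \<omega>) -` A \<inter> space M | A. A \<in> sets borel} \<and>
        prob_space.indep_vars M (\<lambda>_. borel) (\<lambda>l \<omega>. (B t \<omega> - B s \<omega>) $ l) UNIV \<and>
        (\<forall>l. distributed M lborel (\<lambda>\<omega>. (B t \<omega> - B s \<omega>) $ l) (normal_density 0 (sqrt (t - s)))))"

text \<open>Independence of the two processes, regarded as random elements of the path spaces.\<close>

definition independent_processes ::
  "'a measure \<Rightarrow> nat \<Rightarrow> (real \<Rightarrow> 'a \<Rightarrow> real ^ 'm) \<Rightarrow> (real \<Rightarrow> 'a \<Rightarrow> nat) \<Rightarrow> bool" where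
  "independent_processes M N B r \<longleftrightarrow>
     prob_space.indep_set M
       {(\<lambda>\<omega>. \<lambda>t\<in>{0..}. B t \<omega>) -` A \<inter> space M | A. A \<in> sets (PiM {0..} (\<lambda>_. borel))}
       {(\<lambda>\<omega>. \<lambda>t\<in>{0..}. r t \<omega>) -` A \<inter> space M | A. A \<in> sets (PiM {0..} (\<lambda>_. count_space {1..N}))}"

text \<open>
  The Borel sigma-algebra of \<open>C([-\<tau>,0]; \<real>\<^sup>d)\<close> is generated by the point evaluations, so a
  random variable with values there is a process with continuous paths and measurable marginals.
\<close>

definition initial_datum ::
  "'a measure \<Rightarrow> (real \<Rightarrow> 'a measure) \<Rightarrow> real \<Rightarrow> (real \<Rightarrow> 'a \<Rightarrow> real ^ 'd) \<Rightarrow> bool" where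
  "initial_datum M F \<tau> \<xi> \<longleftrightarrow>
     (\<forall>s\<in>{-\<tau>..0}. \<xi> s \<in> borel_measurable (F 0)) \<and>
     (\<forall>\<omega>\<in>space M. continuous_on {-\<tau>..0} (\<lambda>s. \<xi> s \<omega>)) \<and>
     (\<exists>K. AE \<omega> in M. \<forall>s\<in>{-\<tau>..0}. norm (\<xi> s \<omega>) \<le> K)"

definition theta_EM ::
  "'a measure \<Rightarrow> (real ^ 'd \<Rightarrow> nat \<Rightarrow> real ^ 'd) \<Rightarrow>
   (real ^ 'd \<Rightarrow> real ^ 'd \<Rightarrow> real \<Rightarrow> nat \<Rightarrow> real ^ 'd) \<Rightarrow>
   (real ^ 'd \<Rightarrow> real ^ 'd \<Rightarrow> real \<Rightarrow> nat \<Rightarrow> real ^ 'm ^ 'd) \<Rightarrow>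
   (real \<Rightarrow> 'a \<Rightarrow> nat) \<Rightarrow> (real \<Rightarrow> 'a \<Rightarrow> real ^ 'm) \<Rightarrow> (real \<Rightarrow> 'a \<Rightarrow> real ^ 'd) \<Rightarrow>
   real \<Rightarrow> nat \<Rightarrow> real \<Rightarrow> (int \<Rightarrow> 'a \<Rightarrow> real ^ 'd) \<Rightarrow> bool" where
  "theta_EM M D f g r B \<xi> \<theta> n \<Delta> X \<longleftrightarrow>
     (\<forall>\<omega>\<in>space M. \<forall>j\<in>{- int n..0}. X j \<omega> = \<xi> (of_int j * \<Delta>) \<omega>) \<and>
     (\<forall>\<omega>\<in>space M. \<forall>k::int. k \<ge> 0 \<longrightarrow>
        (let t = of_int k * \<Delta>; t' = of_int (k + 1) * \<Delta> in
          X (k + 1) \<omega> - D (X (k + 1 - int n) \<omega>) (r t' \<omega>)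
          = X k \<omega> - D (X (k - int n) \<omega>) (r t \<omega>)
            + \<Delta> *\<^sub>R ((1 - \<theta>) *\<^sub>R f (X k \<omega>) (X (k - int n) \<omega>) t (r t \<omega>)
                   + \<theta> *\<^sub>R f (X (k + 1) \<omega>) (X (k + 1 - int n) \<omega>) t' (r t' \<omega>))
            + g (X k \<omega>) (X (k - int n) \<omega>) t (r t \<omega>) *v (B t' \<omega> - B t \<omega>)))"

text \<open>
  The logarithm on \<open>[0, \<infinity>]\<close> with \<open>log 0 = -\<infinity>\<close> and \<open>log \<infinity> = \<infinity>\<close>; the real \<^const>\<open>ln\<close> has \<open>ln 0 = 0\<close>.
\<close>

definition ext_log :: "ennreal \<Rightarrow> ereal" where
  "ext_log x = (if x = 0 then -\<infinity> else if x = \<infinity> then \<infinity> else ereal (ln (enn2real x)))"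

end

theory Submission
  imports Defs
begin

text \<open>
  Put \<open>Y\<^sub>k = X\<^sub>k - D(X\<^sub>k\<^sub>-\<^sub>n, r\<^sub>k)\<close> and \<open>Z\<^sub>k = Y\<^sub>k - \<theta> \<Delta> f\<^sub>k\<close>. The scheme becomes explicit,
  \<open>Z\<^sub>k\<^sub>+\<^sub>1 = Z\<^sub>k + \<Delta> f\<^sub>k + g\<^sub>k \<Delta>B\<^sub>k\<close>, and dissipativity gives
  \<open>E|Z\<^sub>k\<^sub>+\<^sub>1|\<^sup>2 \<le> E|Z\<^sub>k|\<^sup>2 - (2\<theta> - 1) \<Delta>\<^sup>2 E|f\<^sub>k|\<^sup>2 - C\<^sub>1 \<Delta> E|X\<^sub>k|\<^sup>2 + C\<^sub>2 \<Delta> E|X\<^sub>k\<^sub>-\<^sub>n|\<^sup>2\<close>.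
  As \<open>\<theta> > 1/2\<close>, the negative terms dominate a small multiple of \<open>|Z\<^sub>k|\<^sup>2\<close> up to the delayed term, so
  multiplying by \<open>q\<^sup>k\<close> with \<open>q > 1\<close> close to \<open>1\<close> and summing yields \<open>\<Sum> q\<^sup>k E|X\<^sub>k|\<^sup>2 < \<infinity>\<close>.
  Both stability claims follow from this series.
\<close>

section \<open>A scalar recursion with delay\<close>

text \<open>Weighting by \<open>q ^ k\<close> with \<open>q > 1\<close> creates an extra term
  \<open>(q - 1) * v k\<close>, which \<open>bound\<close> splits into multiples of
  \<open>w k\<close>, \<open>a (k + n)\<close> and \<open>a k\<close>. For \<open>q\<close> close to
  \<open>1\<close> these are absorbed by \<open>c * w k\<close> and by the gap between
  \<open>A\<close> and \<open>C\<close>; the delay costs only a factor \<open>q ^ n\<close>, which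
  is also close to \<open>1\<close>.\<close>

lemma summable_of_delayed_recursion:
  fixes a v w :: "nat \<Rightarrow> real" and n :: nat and A C c b :: real
  assumes nonneg: "\<And>k. 0 \<le> a k" "\<And>k. 0 \<le> v k" "\<And>k. 0 \<le> w k"
    and const: "0 < c" "C < A" "0 \<le> C" "0 \<le> b"
    and rec: "\<And>k. v (Suc k) \<le> v k - c * w k - A * a (k + n) + C * a k"
    and bound: "\<And>k. v k \<le> 2 * w k + 4 * a (k + n) + b * a k"
  obtains q where "q > 1" "summable (\<lambda>k. q ^ k * a (k + n))"
proof -
  \<comment> \<open>\<open>?h q\<close> is the coefficient that finally remains in front of the
    partial sums of \<open>q ^ k * a (k + n)\<close>. It equals \<open>A - C\<close> at
    \<open>q = 1\<close>, so it stays positive for \<open>q\<close> slightly above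
    \<open>1\<close>.\<close>
  let ?h = "\<lambda>q::real. A - 4 * (q - 1) - q ^ n * ((q - 1) * b + q * C)"
  have "(?h \<longlongrightarrow> ?h 1) (at_right 1)"
    by (intro tendsto_intros)
  moreover have "?h 1 > 0" using const by simp
  ultimately have "\<forall>\<^sub>F q in at_right 1. ?h q > 0"
    by (rule order_tendstoD(1))
  \<comment> \<open>This second smallness condition on \<open>q\<close> lets \<open>c * w k\<close>
    absorb the term \<open>2 * (q - 1) * w k\<close> that comes from \<open>bound\<close>.\<close>
  moreover have "((\<lambda>q::real. 2 * (q - 1)) \<longlongrightarrow> 2 * (1 - 1)) (at_right 1)"
    by (intro tendsto_intros)
  then have "\<forall>\<^sub>F q::real in at_right 1. 2 * (q - 1) < c"
    using const(1) by (intro order_tendstoD(2)) auto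
  moreover have "\<forall>\<^sub>F q::real in at_right 1. q > 1"
    by (simp add: eventually_at_right_less)
  ultimately have "\<forall>\<^sub>F q::real in at_right 1. ?h q > 0 \<and> 2 * (q - 1) < c \<and> q > 1"
    by eventually_elim auto
  from eventually_happens'[OF _ this]
  obtain q where q: "?h q > 0" "2 * (q - 1) < c" "q > 1"
    by auto
  define u where "u = (q - 1) * b + q * C"
  define h where "h = A - 4 * (q - 1)"
  have u: "u \<ge> 0" unfolding u_def using q const by simp
  have eta: "h - q ^ n * u > 0" using q(1) unfolding h_def u_def by simp
  have one_step: "q * v (Suc k) - v k \<le> - h * a (k + n) + u * a k" for k
  proof -
    have "q * v (Suc k) \<le> q * (v k - c * w k - A * a (k + n) + C * a k)"
      using rec[of k] q(3) by (intro mult_left_mono) auto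
    moreover have "(q - 1) * v k \<le> (q - 1) * (2 * w k + 4 * a (k + n) + b * a k)"
      using bound[of k] q(3) by (intro mult_left_mono) auto
    moreover have "(2 * (q - 1)) * w k \<le> c * w k"
      using q(2) nonneg by (intro mult_right_mono) auto
    moreover have "0 \<le> (q - 1) * (c * w k)" "0 \<le> (q - 1) * (A * a (k + n))"
      using q(3) nonneg const by auto
    ultimately show ?thesis
      unfolding h_def u_def by (simp add: algebra_simps)
  qed
  let ?S = "\<lambda>K. \<Sum>k<K. q ^ k * a (k + n)" and ?T = "\<lambda>K. \<Sum>k<K. q ^ k * a k"
  have telescoped: "q ^ K * v K \<le> v 0 - h * ?S K + u * ?T K" for K
  proof (induction K)
    case (Suc K)
    have "q ^ K * (q * v (Suc K) - v K) \<le> q ^ K * (- h * a (K + n) + u * a K)"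
      using one_step[of K] q(3) by (intro mult_left_mono) auto
    with Suc show ?case by (simp add: algebra_simps)
  qed simp
  \<comment> \<open>The first \<open>n\<close> terms of \<open>?T\<close> form a fixed constant;
    each later term is a term of \<open>?S\<close> with the additional weight
    \<open>q ^ n\<close>.\<close>
  have shift: "?T K \<le> ?T n + q ^ n * ?S K" for K
  proof -
    have "?T K \<le> ?T (n + K)"
      using nonneg q(3) by (intro sum_mono2) auto
    also have "\<dots> = ?T n + (\<Sum>k<K. q ^ (n + k) * a (n + k))"
      by (induction K) simp_all
    also have "\<dots> = ?T n + q ^ n * ?S K"
      by (simp add: sum_distrib_left power_add add.commute[of n] mult.assoc)
         (simp add: mult.left_commute)
    finally show ?thesis .
  qed
  have "?S K \<le> (v 0 + u * ?T n) / (h - q ^ n * u)" for K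
  proof -
    have "0 \<le> q ^ K * v K" using nonneg q(3) by simp
    with telescoped[of K] mult_left_mono[OF shift[of K] u]
    have "(h - q ^ n * u) * ?S K \<le> v 0 + u * ?T n"
      by (simp add: algebra_simps)
    with eta show ?thesis by (simp add: field_simps)
  qed
  then have "summable (\<lambda>k. q ^ k * a (k + n))"
    using nonneg q(3) by (intro summableI_nonneg_bounded) auto
  with q(3) that show thesis by blast
qed

section \<open>Measurability of implicitly defined random variables\<close>

text \<open>
  No surjectivity is needed: \<open>(x, y) \<mapsto> (\<phi> i x y, y)\<close> is injective and continuous, so it maps
  closed sets, being \<open>\<sigma>\<close>-compact, to Borel sets.
\<close>

lemma borel_measurable_implicit:
  fixes \<phi> :: "'i \<Rightarrow> 'v::euclidean_space \<Rightarrow> 'w::euclidean_space \<Rightarrow> 'u::euclidean_space"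
  assumes I: "countable I" "\<rho> \<in> M \<rightarrow>\<^sub>M count_space I"
    and cont: "\<And>i. i \<in> I \<Longrightarrow> continuous_on UNIV (\<lambda>(x, y). \<phi> i x y)"
    and inj: "\<And>i y. i \<in> I \<Longrightarrow> inj (\<lambda>x. \<phi> i x y)"
    and meas: "u \<in> borel_measurable M" "y \<in> borel_measurable M"
    and eq: "\<And>\<omega>. \<omega> \<in> space M \<Longrightarrow> \<phi> (\<rho> \<omega>) (x \<omega>) (y \<omega>) = u \<omega>"
  shows "x \<in> borel_measurable M"
proof -
  have "x -` K \<inter> space M \<in> sets M" if K: "closed K" for K
  proof -
    define T where "T i = (\<lambda>(x, y). (\<phi> i x y, y)) ` (K \<times> UNIV)" for i
    have T: "T i \<in> sets borel" if i: "i \<in> I" for i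
    proof -
      have cont': "continuous_on A (\<lambda>(x, y). (\<phi> i x y, y))" for A
        using continuous_on_subset[OF cont[OF i] subset_UNIV, of A] unfolding case_prod_beta
        by (intro continuous_intros)
      have comp: "compact ((K \<times> (UNIV :: 'w set)) \<inter> cball 0 (real m))" for m
        using K by (intro closed_Int_compact closed_Times closed_UNIV compact_cball)
      have "\<exists>m::nat. z \<in> cball 0 (real m)" for z :: "'v \<times> 'w"
        using real_arch_simple[of "norm z"] by simp
      then have "(\<Union>m::nat. cball 0 (real m)) = (UNIV :: ('v \<times> 'w) set)"
        by blast
      then have "K \<times> (UNIV :: 'w set) = (\<Union>m::nat. (K \<times> UNIV) \<inter> cball 0 (real m))"
        unfolding Int_UN_distrib[symmetric] by simp
      then have "T i = (\<lambda>(x, y). (\<phi> i x y, y)) ` (\<Union>m::nat. (K \<times> UNIV) \<inter> cball 0 (real m))"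
        unfolding T_def by (rule arg_cong)
      also have "\<dots> = (\<Union>m::nat. (\<lambda>(x, y). (\<phi> i x y, y)) ` ((K \<times> UNIV) \<inter> cball 0 (real m)))"
        by (rule image_UN)
      also have "\<dots> \<in> sets borel"
        by (intro sets.countable_UN borel_compact compact_continuous_image cont' image_subsetI comp)
      finally show ?thesis .
    qed
    \<comment> \<open>Injectivity enters in the converse direction: a point \<open>x'\<close> of
      \<open>K\<close> and \<open>x \<omega>\<close> solve the same equation with the same
      \<open>y \<omega>\<close>, so they coincide.\<close>
    have "x \<omega> \<in> K \<longleftrightarrow> (u \<omega>, y \<omega>) \<in> T (\<rho> \<omega>)" if \<omega>: "\<omega> \<in> space M" for \<omega>
    proof
      assume "x \<omega> \<in> K"
      then show "(u \<omega>, y \<omega>) \<in> T (\<rho> \<omega>)"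
        unfolding T_def using eq[OF \<omega>] by (intro image_eqI[of _ _ "(x \<omega>, y \<omega>)"]) auto
    next
      assume "(u \<omega>, y \<omega>) \<in> T (\<rho> \<omega>)"
      then obtain x' where "x' \<in> K" "\<phi> (\<rho> \<omega>) x' (y \<omega>) = u \<omega>"
        unfolding T_def by auto
      moreover have "\<rho> \<omega> \<in> I"
        using measurable_space[OF I(2) \<omega>] by simp
      ultimately show "x \<omega> \<in> K"
        using eq[OF \<omega>] injD[OF inj[of "\<rho> \<omega>" "y \<omega>"], of x' "x \<omega>"] by simp
    qed
    then have "x -` K \<inter> space M = {\<omega> \<in> space M. (u \<omega>, y \<omega>) \<in> T (\<rho> \<omega>)}"
      by auto
    also have "\<dots> \<in> sets M"
    proof -
      \<comment> \<open>The set \<open>T (\<rho> \<omega>)\<close> is itself random; countability of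
        \<open>I\<close> reduces the claim to each fixed \<open>i\<close>.\<close>
      have "(\<lambda>\<omega>. (u \<omega>, y \<omega>) \<in> T i) \<in> M \<rightarrow>\<^sub>M count_space UNIV" if "i \<in> I" for i
        using T[OF that] meas by measurable
      from measurable_compose_countable'[OF this I(2,1)] show ?thesis
        by (simp add: pred_def)
    qed
    finally show ?thesis .
  qed
  then show ?thesis
    unfolding borel_eq_closed by (intro measurable_measure_of) auto
qed

section \<open>Second moments with an independent increment\<close>

text \<open>Events generated by \<open>h\<close> lie in \<open>F\<close>, and events generated by
  \<open>p (b \<omega>)\<close> are events of \<open>b\<close>. So the independence of
  \<open>F\<close> and \<open>b\<close> passes to these two real variables, and the expectation of
  their product factorizes.\<close>

lemma (in prob_space) integral_mult_indep:
  fixes p :: "'b::topological_space \<Rightarrow> real"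
  assumes sub: "subalgebra M F"
    and h: "h \<in> borel_measurable F" "integrable M h"
    and b: "b \<in> borel_measurable M"
    and indep: "indep_set (sets F) {b -` A \<inter> space M | A. A \<in> sets borel}"
    and p: "p \<in> borel_measurable borel" "integrable M (\<lambda>\<omega>. p (b \<omega>))"
  shows "integrable M (\<lambda>\<omega>. h \<omega> * p (b \<omega>))"
    and "expectation (\<lambda>\<omega>. h \<omega> * p (b \<omega>)) = expectation h * expectation (\<lambda>\<omega>. p (b \<omega>))"
proof -
  have space: "space F = space M" using sub by (simp add: subalgebra_def)
  have 1: "sigma_sets (space M) {h -` A \<inter> space M | A. A \<in> sets borel} \<subseteq> sets F"
    unfolding space[symmetric]
    by (rule sets.sigma_sets_subset) (use h(1) in \<open>auto simp: measurable_sets\<close>)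
  let ?B = "{b -` A \<inter> space M | A. A \<in> sets borel}"
  have "{(\<lambda>\<omega>. p (b \<omega>)) -` A \<inter> space M | A. A \<in> sets borel} \<subseteq> ?B"
  proof safe
    fix A :: "real set" assume "A \<in> sets borel"
    then have "p -` A \<in> sets borel" using p(1) by (simp add: measurable_sets_borel)
    then show "\<exists>A'. (\<lambda>\<omega>. p (b \<omega>)) -` A \<inter> space M = b -` A' \<inter> space M \<and> A' \<in> sets borel"
      by (intro exI[of _ "p -` A"]) auto
  qed
  \<comment> \<open>The preimages under \<open>b\<close> already form a sigma-algebra, so the
    sigma-algebra generated by a subfamily stays inside \<open>?B\<close>.\<close>
  moreover have "?B = sets (vimage_algebra (space M) b borel)"
    by (subst sets_vimage_algebra2) auto
  ultimately have 2: "sigma_sets (space M) {(\<lambda>\<omega>. p (b \<omega>)) -` A \<inter> space M | A. A \<in> sets borel} \<subseteq> ?B"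
    using sets.sigma_sets_subset[of _ "vimage_algebra (space M) b borel"] by simp
  have "h \<in> borel_measurable M" using measurable_from_subalg[OF sub h(1)] .
  moreover have "(\<lambda>\<omega>. p (b \<omega>)) \<in> borel_measurable M" using b p(1) by measurable
  moreover have "indep_set (sigma_sets (space M) {h -` A \<inter> space M | A. A \<in> sets borel})
      (sigma_sets (space M) {(\<lambda>\<omega>. p (b \<omega>)) -` A \<inter> space M | A. A \<in> sets borel})"
    using indep unfolding indep_set_def
    by (rule indep_sets_mono_sets) (simp only: 1 2 bool.case split: bool.split, simp)
  ultimately have "indep_var borel h borel (\<lambda>\<omega>. p (b \<omega>))"
    unfolding indep_var_eq by (intro conjI)
  from indep_var_integrable[OF this h(2) p(2)] indep_var_lebesgue_integral[OF this h(2) p(2)]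
  show "integrable M (\<lambda>\<omega>. h \<omega> * p (b \<omega>))"
    and "expectation (\<lambda>\<omega>. h \<omega> * p (b \<omega>)) = expectation h * expectation (\<lambda>\<omega>. p (b \<omega>))"
    by auto
qed

lemma integrable_mult_square_integrable:
  fixes f g :: "'a \<Rightarrow> real"
  assumes "f \<in> borel_measurable M" "g \<in> borel_measurable M"
    and "integrable M (\<lambda>x. (f x)\<^sup>2)" "integrable M (\<lambda>x. (g x)\<^sup>2)"
  shows "integrable M (\<lambda>x. f x * g x)"
proof (rule Bochner_Integration.integrable_bound)
  show "integrable M (\<lambda>x. (f x)\<^sup>2 + (g x)\<^sup>2)" using assms by simp
  have "\<bar>a * b\<bar> \<le> a\<^sup>2 + b\<^sup>2" for a b :: real
    using sum_squares_bound[of "\<bar>a\<bar>" "\<bar>b\<bar>"] abs_ge_zero[of "a * b"]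
    unfolding power2_abs mult.assoc abs_mult[symmetric] by linarith
  then have "\<bar>a * b\<bar> \<le> \<bar>a\<^sup>2 + b\<^sup>2\<bar>" for a b :: real
    by (rule order_trans) simp
  then show "AE x in M. norm (f x * g x) \<le> norm ((f x)\<^sup>2 + (g x)\<^sup>2)" by simp
qed (use assms in measurable)

lemma integrable_norm_le:
  fixes f :: "'a \<Rightarrow> 'b::{second_countable_topology, real_normed_vector}" and g :: "'a \<Rightarrow> real"
  assumes "integrable M g" "f \<in> borel_measurable M" "\<And>x. x \<in> space M \<Longrightarrow> (norm (f x))\<^sup>2 \<le> g x"
  shows "integrable M (\<lambda>x. (norm (f x))\<^sup>2)"
  by (rule Bochner_Integration.integrable_bound[OF assms(1)])
     (use assms in \<open>auto intro!: AE_I2 order_trans[OF assms(3)]\<close>)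

lemma borel_measurable_vec_nth_row:
  "(\<lambda>x :: real ^ 'm ^ 'n. x $ i) \<in> borel_measurable borel"
  by (intro borel_measurable_continuous_onI continuous_intros)

lemma norm_vec_sum_squares: "(norm (x :: real ^ 'n))\<^sup>2 = (\<Sum>i\<in>UNIV. (x $ i)\<^sup>2)"
  by (simp add: norm_vec_def L2_set_def sum_nonneg)

lemma norm_matrix_sum_squares: "(norm (A :: real ^ 'm ^ 'n))\<^sup>2 = (\<Sum>i\<in>UNIV. \<Sum>j\<in>UNIV. (A $ i $ j)\<^sup>2)"
  by (simp add: norm_vec_def L2_set_def sum_nonneg)

text \<open>The terms are grouped so that each summand is a factor in \<open>v\<close> and
  \<open>G\<close> times a monomial in the coordinates of \<open>b\<close>, the form to which
  \<open>integral_mult_indep\<close> applies.\<close>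

lemma norm_add_matrix_vector_squared:
  fixes v :: "real ^ 'd" and G :: "real ^ 'm ^ 'd"
  shows "(norm (v + G *v b))\<^sup>2 = (norm v)\<^sup>2 + (\<Sum>i\<in>UNIV. \<Sum>l\<in>UNIV. (2 * (v $ i) * G $ i $ l) * b $ l)
    + (\<Sum>i\<in>UNIV. \<Sum>l\<in>UNIV. \<Sum>l'\<in>UNIV. (G $ i $ l * G $ i $ l') * (b $ l * b $ l'))"
proof -
  have "((v + G *v b) $ i)\<^sup>2 = (v $ i)\<^sup>2 + (\<Sum>l\<in>UNIV. (2 * (v $ i) * G $ i $ l) * b $ l)
    + (\<Sum>l\<in>UNIV. \<Sum>l'\<in>UNIV. (G $ i $ l * G $ i $ l') * (b $ l * b $ l'))" for i
  proof -
    have "2 * (v $ i) * (\<Sum>l\<in>UNIV. G $ i $ l * b $ l) = (\<Sum>l\<in>UNIV. (2 * (v $ i) * G $ i $ l) * b $ l)"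
      by (simp add: sum_distrib_left mult.assoc)
    moreover have "(\<Sum>l\<in>UNIV. G $ i $ l * b $ l)\<^sup>2
        = (\<Sum>l\<in>UNIV. \<Sum>l'\<in>UNIV. (G $ i $ l * G $ i $ l') * (b $ l * b $ l'))"
      unfolding power2_eq_square sum_product by (intro sum.cong refl) (simp add: mult.assoc mult.left_commute)
    ultimately show ?thesis
      by (simp add: matrix_vector_mult_def power2_sum)
  qed
  then show ?thesis
    unfolding norm_vec_sum_squares by (simp add: sum.distrib)
qed

text \<open>A one-step Ito isometry: by independence the terms linear in \<open>b\<close> vanish
  because \<open>b\<close> has mean zero, the mixed quadratic terms vanish because distinct
  coordinates are uncorrelated, and the diagonal ones add up to \<open>\<delta>\<close> times the
  squared Hilbert-Schmidt norm of \<open>G\<close>.\<close>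

lemma (in prob_space) second_moment_add_matrix_vector:
  fixes v :: "'a \<Rightarrow> real ^ 'd" and G :: "'a \<Rightarrow> real ^ 'm ^ 'd" and b :: "'a \<Rightarrow> real ^ 'm"
  assumes sub: "subalgebra M F"
    and v: "v \<in> borel_measurable F" "integrable M (\<lambda>\<omega>. (norm (v \<omega>))\<^sup>2)"
    and G: "G \<in> borel_measurable F" "integrable M (\<lambda>\<omega>. (norm (G \<omega>))\<^sup>2)"
    and b: "b \<in> borel_measurable M"
    and indep: "indep_set (sets F) {b -` A \<inter> space M | A. A \<in> sets borel}"
    and mean: "\<And>l. integrable M (\<lambda>\<omega>. b \<omega> $ l)" "\<And>l. expectation (\<lambda>\<omega>. b \<omega> $ l) = 0"
    and cov: "\<And>l l'. integrable M (\<lambda>\<omega>. b \<omega> $ l * b \<omega> $ l')"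
      "\<And>l l'. expectation (\<lambda>\<omega>. b \<omega> $ l * b \<omega> $ l') = (if l = l' then \<delta> else 0)"
  shows "integrable M (\<lambda>\<omega>. (norm (v \<omega> + G \<omega> *v b \<omega>))\<^sup>2)"
    and "expectation (\<lambda>\<omega>. (norm (v \<omega> + G \<omega> *v b \<omega>))\<^sup>2)
      = expectation (\<lambda>\<omega>. (norm (v \<omega>))\<^sup>2) + \<delta> * expectation (\<lambda>\<omega>. (norm (G \<omega>))\<^sup>2)"
proof -
  have vF: "(\<lambda>\<omega>. v \<omega> $ i) \<in> borel_measurable F" for i
    by (rule measurable_compose[OF v(1) borel_measurable_nth])
  have GF: "(\<lambda>\<omega>. G \<omega> $ i $ l) \<in> borel_measurable F" for i l
    by (rule measurable_compose[OF measurable_compose[OF G(1) borel_measurable_vec_nth_row] borel_measurable_nth])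
  note vM = measurable_from_subalg[OF sub vF] and GM = measurable_from_subalg[OF sub GF]
  have v2: "integrable M (\<lambda>\<omega>. (v \<omega> $ i)\<^sup>2)" for i
  proof -
    have "integrable M (\<lambda>\<omega>. (norm (v \<omega> $ i))\<^sup>2)"
      by (rule integrable_norm_le[OF v(2) vM]) (intro power_mono Finite_Cartesian_Product.norm_nth_le norm_ge_zero)
    then show ?thesis by simp
  qed
  have G2: "integrable M (\<lambda>\<omega>. (G \<omega> $ i $ l)\<^sup>2)" for i l
  proof -
    have "integrable M (\<lambda>\<omega>. (norm (G \<omega> $ i $ l))\<^sup>2)"
      by (rule integrable_norm_le[OF G(2) GM])
         (intro power_mono order_trans[OF Finite_Cartesian_Product.norm_nth_le Finite_Cartesian_Product.norm_nth_le] norm_ge_zero)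
    then show ?thesis by simp
  qed
  have vG: "integrable M (\<lambda>\<omega>. 2 * (v \<omega> $ i) * G \<omega> $ i $ l)" for i l
    using integrable_mult_square_integrable[OF vM GM v2 G2] by (simp add: mult.assoc)
  have GG: "integrable M (\<lambda>\<omega>. G \<omega> $ i $ l * G \<omega> $ i $ l')" for i l l'
    using integrable_mult_square_integrable[OF GM GM G2 G2] by simp
  have lin: "integrable M (\<lambda>\<omega>. 2 * v \<omega> $ i * G \<omega> $ i $ l * b \<omega> $ l)"
    "expectation (\<lambda>\<omega>. 2 * v \<omega> $ i * G \<omega> $ i $ l * b \<omega> $ l) = 0" for i l
  proof -
    have "(\<lambda>\<omega>. 2 * v \<omega> $ i * G \<omega> $ i $ l) \<in> borel_measurable F"
      using vF GF by (intro borel_measurable_times) auto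
    from integral_mult_indep[OF sub this vG b indep borel_measurable_nth mean(1)]
    show "integrable M (\<lambda>\<omega>. 2 * v \<omega> $ i * G \<omega> $ i $ l * b \<omega> $ l)"
      "expectation (\<lambda>\<omega>. 2 * v \<omega> $ i * G \<omega> $ i $ l * b \<omega> $ l) = 0"
      by (simp_all add: mean(2))
  qed
  have quad: "integrable M (\<lambda>\<omega>. G \<omega> $ i $ l * G \<omega> $ i $ l' * (b \<omega> $ l * b \<omega> $ l'))"
    "expectation (\<lambda>\<omega>. G \<omega> $ i $ l * G \<omega> $ i $ l' * (b \<omega> $ l * b \<omega> $ l'))
      = (if l = l' then \<delta> * expectation (\<lambda>\<omega>. (G \<omega> $ i $ l)\<^sup>2) else 0)" for i l l'
  proof -
    have "(\<lambda>\<omega>. G \<omega> $ i $ l * G \<omega> $ i $ l') \<in> borel_measurable F"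
      using GF by (intro borel_measurable_times) auto
    moreover have "(\<lambda>x :: real ^ 'm. x $ l * x $ l') \<in> borel_measurable borel"
      by (intro borel_measurable_times borel_measurable_nth)
    ultimately have "integrable M (\<lambda>\<omega>. G \<omega> $ i $ l * G \<omega> $ i $ l' * (b \<omega> $ l * b \<omega> $ l'))"
      "expectation (\<lambda>\<omega>. G \<omega> $ i $ l * G \<omega> $ i $ l' * (b \<omega> $ l * b \<omega> $ l'))
        = expectation (\<lambda>\<omega>. G \<omega> $ i $ l * G \<omega> $ i $ l') * expectation (\<lambda>\<omega>. b \<omega> $ l * b \<omega> $ l')"
      using integral_mult_indep[OF sub _ GG b indep _ cov(1)] by auto
    then show "integrable M (\<lambda>\<omega>. G \<omega> $ i $ l * G \<omega> $ i $ l' * (b \<omega> $ l * b \<omega> $ l'))"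
      "expectation (\<lambda>\<omega>. G \<omega> $ i $ l * G \<omega> $ i $ l' * (b \<omega> $ l * b \<omega> $ l'))
      = (if l = l' then \<delta> * expectation (\<lambda>\<omega>. (G \<omega> $ i $ l)\<^sup>2) else 0)"
      by (auto simp: cov(2) power2_eq_square)
  qed
  show "integrable M (\<lambda>\<omega>. (norm (v \<omega> + G \<omega> *v b \<omega>))\<^sup>2)"
    unfolding norm_add_matrix_vector_squared using v(2) lin quad by simp
  show "expectation (\<lambda>\<omega>. (norm (v \<omega> + G \<omega> *v b \<omega>))\<^sup>2)
      = expectation (\<lambda>\<omega>. (norm (v \<omega>))\<^sup>2) + \<delta> * expectation (\<lambda>\<omega>. (norm (G \<omega>))\<^sup>2)"
    unfolding norm_add_matrix_vector_squared norm_matrix_sum_squares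
    using v(2) lin quad G2 by (simp add: sum_distrib_left)
qed

section \<open>Energy estimate for the split-step form\<close>

text \<open>Here \<open>w (k + n)\<close> is the current value, \<open>w k\<close> the delayed one,
  and \<open>\<phi>\<close>, \<open>G\<close> are drift and diffusion along the solution. Square
  integrability is given for the initial segment and \<open>Z 0\<close>, and dissipativity
  propagates it to all later steps; then the second moments of \<open>Z\<close> obey the recursion
  of \<open>summable_of_delayed_recursion\<close>.\<close>

lemma (in prob_space) split_step_summable:
  fixes w Y \<phi> :: "nat \<Rightarrow> 'a \<Rightarrow> real ^ 'd"
    and G :: "nat \<Rightarrow> 'a \<Rightarrow> real ^ 'm ^ 'd" and b :: "nat \<Rightarrow> 'a \<Rightarrow> real ^ 'm"
    and A :: "nat \<Rightarrow> 'a measure" and \<theta> h C\<^sub>1 C\<^sub>2 \<beta> :: real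
  defines "Z \<equiv> \<lambda>k \<omega>. Y k \<omega> - (\<theta> * h) *\<^sub>R \<phi> k \<omega>"
  assumes sub: "\<And>k. subalgebra M (A k)"
    and w: "\<And>k. w k \<in> borel_measurable M"
    and Y: "\<And>k. Y k \<in> borel_measurable (A k)"
    and \<phi>: "\<And>k. \<phi> k \<in> borel_measurable (A k)"
    and G: "\<And>k. G k \<in> borel_measurable (A k)"
    and b: "\<And>k. b k \<in> borel_measurable M"
    and indep: "\<And>k. indep_set (sets (A k)) {b k -` S \<inter> space M | S. S \<in> sets borel}"
    and mean: "\<And>k l. integrable M (\<lambda>\<omega>. b k \<omega> $ l)" "\<And>k l. expectation (\<lambda>\<omega>. b k \<omega> $ l) = 0"
    and cov: "\<And>k l l'. integrable M (\<lambda>\<omega>. b k \<omega> $ l * b k \<omega> $ l')"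
      "\<And>k l l'. expectation (\<lambda>\<omega>. b k \<omega> $ l * b k \<omega> $ l') = (if l = l' then h else 0)"
    and start: "\<And>k. k < n \<Longrightarrow> integrable M (\<lambda>\<omega>. (norm (w k \<omega>))\<^sup>2)"
      "integrable M (\<lambda>\<omega>. (norm (Z 0 \<omega>))\<^sup>2)"
    and step: "\<And>k \<omega>. \<omega> \<in> space M \<Longrightarrow> Z (Suc k) \<omega> = Z k \<omega> + h *\<^sub>R \<phi> k \<omega> + G k \<omega> *v b k \<omega>"
    and dissip: "\<And>k \<omega>. \<omega> \<in> space M \<Longrightarrow> 2 * (Y k \<omega> \<bullet> \<phi> k \<omega>) + (norm (G k \<omega>))\<^sup>2
      \<le> - C\<^sub>1 * (norm (w (k + n) \<omega>))\<^sup>2 + C\<^sub>2 * (norm (w k \<omega>))\<^sup>2"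
    and Y_bound: "\<And>k \<omega>. \<omega> \<in> space M \<Longrightarrow> norm (Y k \<omega>) \<le> norm (w (k + n) \<omega>) + \<beta> * norm (w k \<omega>)"
    and const: "0 < h" "1 / 2 < \<theta>" "0 \<le> C\<^sub>2" "C\<^sub>2 < C\<^sub>1" "1 \<le> n"
  obtains q where "q > 1" "\<And>k. integrable M (\<lambda>\<omega>. (norm (w k \<omega>))\<^sup>2)"
    "summable (\<lambda>k. q ^ k * expectation (\<lambda>\<omega>. (norm (w (k + n) \<omega>))\<^sup>2))"
proof -
  have Z: "Z k \<in> borel_measurable (A k)" for k
    unfolding Z_def using Y \<phi> by measurable
  have YM: "Y k \<in> borel_measurable M" and \<phi>M: "\<phi> k \<in> borel_measurable M"
    and GM: "G k \<in> borel_measurable M" and ZM: "Z k \<in> borel_measurable M" for k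
    using measurable_from_subalg[OF sub] Y \<phi> G Z by blast+
  have Z_sq: "(norm (Z k \<omega>))\<^sup>2
      = (norm (Y k \<omega>))\<^sup>2 - \<theta> * h * (2 * (Y k \<omega> \<bullet> \<phi> k \<omega>)) + (\<theta> * h)\<^sup>2 * (norm (\<phi> k \<omega>))\<^sup>2" for k \<omega>
    unfolding Z_def power2_norm_eq_inner
    by (simp add: inner_diff inner_commute power2_eq_square algebra_simps)
  \<comment> \<open>The vector on the left is \<open>Y k \<omega> + ((1 - \<theta>) * h) *\<^sub>R
    \<phi> k \<omega>\<close>, and the last coefficient comes from \<open>(1 - \<theta>)\<^sup>2 -
    \<theta>\<^sup>2 = - (2 * \<theta> - 1)\<close>. It is negative as \<open>\<theta>\<close>
    exceeds \<open>1 / 2\<close>.\<close>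
  have Zh_sq: "(norm (Z k \<omega> + h *\<^sub>R \<phi> k \<omega>))\<^sup>2
      = (norm (Z k \<omega>))\<^sup>2 + h * (2 * (Y k \<omega> \<bullet> \<phi> k \<omega>)) - (2 * \<theta> - 1) * h\<^sup>2 * (norm (\<phi> k \<omega>))\<^sup>2" for k \<omega>
    unfolding Z_def power2_norm_eq_inner
    by (simp add: inner_diff inner_add inner_commute power2_eq_square algebra_simps)
  \<comment> \<open>All summands on the left are nonnegative, so each is controlled by
    \<open>Z k\<close> and the delayed value alone. This gives integrability of
    \<open>\<phi> k\<close> and \<open>G k\<close> from dissipativity, in place of a growth
    condition.\<close>
  have apriori: "(norm (Y k \<omega>))\<^sup>2 + \<theta> * h * (C\<^sub>1 * (norm (w (k + n) \<omega>))\<^sup>2 + (norm (G k \<omega>))\<^sup>2)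
      + (\<theta> * h)\<^sup>2 * (norm (\<phi> k \<omega>))\<^sup>2 \<le> (norm (Z k \<omega>))\<^sup>2 + \<theta> * h * (C\<^sub>2 * (norm (w k \<omega>))\<^sup>2)"
    if "\<omega> \<in> space M" for k \<omega>
  proof -
    have "\<theta> * h * (2 * (Y k \<omega> \<bullet> \<phi> k \<omega>) + (norm (G k \<omega>))\<^sup>2)
        \<le> \<theta> * h * (- C\<^sub>1 * (norm (w (k + n) \<omega>))\<^sup>2 + C\<^sub>2 * (norm (w k \<omega>))\<^sup>2)"
      using dissip[OF that, of k] const by (intro mult_left_mono) auto
    then show ?thesis unfolding Z_sq by (simp add: algebra_simps)
  qed
  have \<theta>h: "0 < \<theta> * h" and C1: "0 < C\<^sub>1" using const by auto
  have integrable_step: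
    "integrable M (\<lambda>\<omega>. (norm (w (k + n) \<omega>))\<^sup>2)" "integrable M (\<lambda>\<omega>. (norm (Y k \<omega>))\<^sup>2)"
    "integrable M (\<lambda>\<omega>. (norm (G k \<omega>))\<^sup>2)" "integrable M (\<lambda>\<omega>. (norm (\<phi> k \<omega>))\<^sup>2)"
    if "integrable M (\<lambda>\<omega>. (norm (Z k \<omega>))\<^sup>2)" "integrable M (\<lambda>\<omega>. (norm (w k \<omega>))\<^sup>2)" for k
  proof -
    define R where "R \<omega> = (norm (Z k \<omega>))\<^sup>2 + \<theta> * h * (C\<^sub>2 * (norm (w k \<omega>))\<^sup>2)" for \<omega>
    have R: "integrable M R" unfolding R_def using that by simp
    have nonneg: "0 \<le> (norm (Y k \<omega>))\<^sup>2" "0 \<le> \<theta> * h * (C\<^sub>1 * (norm (w (k + n) \<omega>))\<^sup>2)"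
      "0 \<le> \<theta> * h * (norm (G k \<omega>))\<^sup>2" "0 \<le> (\<theta> * h)\<^sup>2 * (norm (\<phi> k \<omega>))\<^sup>2" for \<omega>
      using \<theta>h C1 by simp_all
    have ap: "\<theta> * h * (C\<^sub>1 * (norm (w (k + n) \<omega>))\<^sup>2) \<le> R \<omega>" "(norm (Y k \<omega>))\<^sup>2 \<le> R \<omega>"
      "\<theta> * h * (norm (G k \<omega>))\<^sup>2 \<le> R \<omega>" "(\<theta> * h)\<^sup>2 * (norm (\<phi> k \<omega>))\<^sup>2 \<le> R \<omega>"
      if "\<omega> \<in> space M" for \<omega>
      using apriori[OF that, of k, folded R_def, unfolded distrib_left[of "\<theta> * h" "C\<^sub>1 * _"]] nonneg[of \<omega>]
      by linarith+
    have "(norm (w (k + n) \<omega>))\<^sup>2 \<le> R \<omega> / (\<theta> * h * C\<^sub>1)" if "\<omega> \<in> space M" for \<omega>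
      using ap(1)[OF that] mult_pos_pos[OF \<theta>h C1] by (simp add: pos_le_divide_eq ac_simps)
    then show "integrable M (\<lambda>\<omega>. (norm (w (k + n) \<omega>))\<^sup>2)"
      by (rule integrable_norm_le[OF integrable_divide[OF R] w])
    show "integrable M (\<lambda>\<omega>. (norm (Y k \<omega>))\<^sup>2)"
      by (rule integrable_norm_le[OF R YM ap(2)])
    have "(norm (G k \<omega>))\<^sup>2 \<le> R \<omega> / (\<theta> * h)" if "\<omega> \<in> space M" for \<omega>
      using ap(3)[OF that] \<theta>h by (simp add: pos_le_divide_eq ac_simps)
    then show "integrable M (\<lambda>\<omega>. (norm (G k \<omega>))\<^sup>2)"
      by (rule integrable_norm_le[OF integrable_divide[OF R] GM])
    have "(norm (\<phi> k \<omega>))\<^sup>2 \<le> R \<omega> / (\<theta> * h)\<^sup>2" if "\<omega> \<in> space M" for \<omega>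
      using ap(4)[OF that] zero_less_power[OF \<theta>h, of 2] by (simp add: pos_le_divide_eq mult.commute)
    then show "integrable M (\<lambda>\<omega>. (norm (\<phi> k \<omega>))\<^sup>2)"
      by (rule integrable_norm_le[OF integrable_divide[OF R] \<phi>M])
  qed
  have next_step: "integrable M (\<lambda>\<omega>. (norm (Z (Suc k) \<omega>))\<^sup>2)"
    "expectation (\<lambda>\<omega>. (norm (Z (Suc k) \<omega>))\<^sup>2)
      = expectation (\<lambda>\<omega>. (norm (Z k \<omega> + h *\<^sub>R \<phi> k \<omega>))\<^sup>2) + h * expectation (\<lambda>\<omega>. (norm (G k \<omega>))\<^sup>2)"
    "integrable M (\<lambda>\<omega>. (norm (Z k \<omega> + h *\<^sub>R \<phi> k \<omega>))\<^sup>2)"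
    if "integrable M (\<lambda>\<omega>. (norm (Z k \<omega>))\<^sup>2)" "integrable M (\<lambda>\<omega>. (norm (w k \<omega>))\<^sup>2)" for k
  proof -
    have meas: "(\<lambda>\<omega>. Z k \<omega> + h *\<^sub>R \<phi> k \<omega>) \<in> borel_measurable (A k)"
      using Z \<phi> by measurable
    have "(norm (Z k \<omega> + h *\<^sub>R \<phi> k \<omega>))\<^sup>2 \<le> 2 * (norm (Z k \<omega>))\<^sup>2 + 2 * h\<^sup>2 * (norm (\<phi> k \<omega>))\<^sup>2" for \<omega>
    proof -
      have "(norm (Z k \<omega> + h *\<^sub>R \<phi> k \<omega>))\<^sup>2 \<le> (norm (Z k \<omega>) + norm (h *\<^sub>R \<phi> k \<omega>))\<^sup>2"
        by (intro power_mono norm_triangle_ineq) auto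
      also have "\<dots> \<le> 2 * (norm (Z k \<omega>))\<^sup>2 + 2 * (norm (h *\<^sub>R \<phi> k \<omega>))\<^sup>2"
        using sum_squares_bound[of "norm (Z k \<omega>)" "norm (h *\<^sub>R \<phi> k \<omega>)"] by (simp add: power2_sum)
      finally show ?thesis by (simp add: power_mult_distrib)
    qed
    then show int: "integrable M (\<lambda>\<omega>. (norm (Z k \<omega> + h *\<^sub>R \<phi> k \<omega>))\<^sup>2)"
      using integrable_step(4)[OF that] that(1) measurable_from_subalg[OF sub meas]
      by (intro integrable_norm_le[of _ "\<lambda>\<omega>. 2 * (norm (Z k \<omega>))\<^sup>2 + 2 * h\<^sup>2 * (norm (\<phi> k \<omega>))\<^sup>2"]) simp_all
    note moment = second_moment_add_matrix_vector[OF sub meas int G integrable_step(3)[OF that]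
        b indep mean cov]
    show "integrable M (\<lambda>\<omega>. (norm (Z (Suc k) \<omega>))\<^sup>2)"
      using moment(1) by (simp add: step cong: Bochner_Integration.integrable_cong)
    show "expectation (\<lambda>\<omega>. (norm (Z (Suc k) \<omega>))\<^sup>2)
      = expectation (\<lambda>\<omega>. (norm (Z k \<omega> + h *\<^sub>R \<phi> k \<omega>))\<^sup>2) + h * expectation (\<lambda>\<omega>. (norm (G k \<omega>))\<^sup>2)"
      using moment(2) by (simp add: step cong: Bochner_Integration.integral_cong)
  qed
  \<comment> \<open>The horizon for \<open>w\<close> is \<open>k + n\<close>. Since
    \<open>1 \<le> n\<close>, it includes the delayed value \<open>w k\<close>, which together with
    \<open>Z k\<close> yields the new items \<open>w (k + n)\<close> and
    \<open>Z (Suc k)\<close>.\<close>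
  have all: "(\<forall>j<k + n. integrable M (\<lambda>\<omega>. (norm (w j \<omega>))\<^sup>2)) \<and> integrable M (\<lambda>\<omega>. (norm (Z k \<omega>))\<^sup>2)" for k
  proof (induction k)
    case (Suc k)
    then have "integrable M (\<lambda>\<omega>. (norm (Z k \<omega>))\<^sup>2)" "integrable M (\<lambda>\<omega>. (norm (w k \<omega>))\<^sup>2)"
      using const by auto
    with Suc integrable_step(1) next_step(1) show ?case
      by (auto simp: less_Suc_eq)
  qed (use start in auto)
  have intZ: "integrable M (\<lambda>\<omega>. (norm (Z k \<omega>))\<^sup>2)" and intw: "integrable M (\<lambda>\<omega>. (norm (w k \<omega>))\<^sup>2)" for k
    using all[of k] all[of "Suc k"] by auto
  note int = integrable_step[OF intZ intw] intZ intw next_step(3)[OF intZ intw]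
  define a where "a k = expectation (\<lambda>\<omega>. (norm (w k \<omega>))\<^sup>2)" for k
  define v where "v k = expectation (\<lambda>\<omega>. (norm (Z k \<omega>))\<^sup>2)" for k
  define p where "p k = expectation (\<lambda>\<omega>. (norm (\<phi> k \<omega>))\<^sup>2)" for k
  have rec: "v (Suc k) \<le> v k - (2 * \<theta> - 1) * h\<^sup>2 * p k - h * C\<^sub>1 * a (k + n) + h * C\<^sub>2 * a k" for k
  proof -
    \<comment> \<open>The increment now appears only through \<open>h\<close> times the squared norm
      of \<open>G k\<close>. Adding
      \<open>h * (2 * (Y k \<omega> \<bullet> \<phi> k \<omega>))\<close> from \<open>Zh_sq\<close>
      produces exactly \<open>h\<close> times the left side of \<open>dissip\<close>.\<close>
    have "v (Suc k) = expectation (\<lambda>\<omega>. (norm (Z k \<omega> + h *\<^sub>R \<phi> k \<omega>))\<^sup>2 + h * (norm (G k \<omega>))\<^sup>2)"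
      unfolding v_def next_step(2)[OF intZ intw] using int by simp
    also have "\<dots> \<le> expectation (\<lambda>\<omega>. (norm (Z k \<omega>))\<^sup>2 - (2 * \<theta> - 1) * h\<^sup>2 * (norm (\<phi> k \<omega>))\<^sup>2
        - h * C\<^sub>1 * (norm (w (k + n) \<omega>))\<^sup>2 + h * C\<^sub>2 * (norm (w k \<omega>))\<^sup>2)"
    proof (rule integral_mono)
      fix \<omega> assume "\<omega> \<in> space M"
      from mult_left_mono[OF dissip[OF this, of k], of h]
      show "(norm (Z k \<omega> + h *\<^sub>R \<phi> k \<omega>))\<^sup>2 + h * (norm (G k \<omega>))\<^sup>2
        \<le> (norm (Z k \<omega>))\<^sup>2 - (2 * \<theta> - 1) * h\<^sup>2 * (norm (\<phi> k \<omega>))\<^sup>2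
        - h * C\<^sub>1 * (norm (w (k + n) \<omega>))\<^sup>2 + h * C\<^sub>2 * (norm (w k \<omega>))\<^sup>2"
        unfolding Zh_sq using const by (simp add: algebra_simps)
    qed (use int in auto)
    also have "\<dots> = v k - (2 * \<theta> - 1) * h\<^sup>2 * p k - h * C\<^sub>1 * a (k + n) + h * C\<^sub>2 * a k"
      unfolding v_def p_def a_def using int by simp
    finally show ?thesis .
  qed
  \<comment> \<open>The constants arise from applying the inequality \<open>sq\<close> twice: first
    to \<open>Y\<close> against the drift, then to the two parts of \<open>Y_bound\<close>.\<close>
  have bound: "v k \<le> 2 * ((\<theta> * h)\<^sup>2 * p k) + 4 * a (k + n) + 4 * \<beta>\<^sup>2 * a k" for k
  proof -
    have "v k \<le> expectation (\<lambda>\<omega>. 2 * ((\<theta> * h)\<^sup>2 * (norm (\<phi> k \<omega>))\<^sup>2)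
        + 4 * (norm (w (k + n) \<omega>))\<^sup>2 + 4 * \<beta>\<^sup>2 * (norm (w k \<omega>))\<^sup>2)"
      unfolding v_def
    proof (rule integral_mono)
      fix \<omega> assume \<omega>: "\<omega> \<in> space M"
      have sq: "(x + y)\<^sup>2 \<le> 2 * x\<^sup>2 + 2 * y\<^sup>2" for x y :: real
        using sum_squares_bound[of x y] by (simp add: power2_sum)
      have "norm (Z k \<omega>) \<le> norm (Y k \<omega>) + \<theta> * h * norm (\<phi> k \<omega>)"
        unfolding Z_def using norm_triangle_ineq4[of "Y k \<omega>" "(\<theta> * h) *\<^sub>R \<phi> k \<omega>"] \<theta>h by simp
      then have "(norm (Z k \<omega>))\<^sup>2 \<le> (norm (Y k \<omega>) + \<theta> * h * norm (\<phi> k \<omega>))\<^sup>2"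
        by (intro power_mono) auto
      also note sq
      also have "(norm (Y k \<omega>))\<^sup>2 \<le> (norm (w (k + n) \<omega>) + \<beta> * norm (w k \<omega>))\<^sup>2"
        using Y_bound[OF \<omega>] by (intro power_mono) auto
      also note sq
      finally show "(norm (Z k \<omega>))\<^sup>2 \<le> 2 * ((\<theta> * h)\<^sup>2 * (norm (\<phi> k \<omega>))\<^sup>2)
          + 4 * (norm (w (k + n) \<omega>))\<^sup>2 + 4 * \<beta>\<^sup>2 * (norm (w k \<omega>))\<^sup>2"
        by (simp add: power_mult_distrib algebra_simps)
    qed (use int in auto)
    also have "\<dots> = 2 * ((\<theta> * h)\<^sup>2 * p k) + 4 * a (k + n) + 4 * \<beta>\<^sup>2 * a k"
      unfolding p_def a_def using int by simp
    finally show ?thesis .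
  qed
  \<comment> \<open>The constant \<open>(2 * \<theta> - 1) / \<theta>\<^sup>2\<close> is chosen so
    that its product with \<open>(\<theta> * h)\<^sup>2 * p k\<close> is the drift term of
    \<open>rec\<close>; it is positive because \<open>\<theta>\<close> exceeds
    \<open>1 / 2\<close>.\<close>
  obtain q where "q > 1" "summable (\<lambda>k. q ^ k * a (k + n))"
  proof (rule summable_of_delayed_recursion[of a v "\<lambda>k. (\<theta> * h)\<^sup>2 * p k" "(2 * \<theta> - 1) / \<theta>\<^sup>2"
        "h * C\<^sub>2" "h * C\<^sub>1" "4 * \<beta>\<^sup>2" n])
    show "v (Suc k) \<le> v k - (2 * \<theta> - 1) / \<theta>\<^sup>2 * ((\<theta> * h)\<^sup>2 * p k) - h * C\<^sub>1 * a (k + n) + h * C\<^sub>2 * a k" for k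
      using rec[of k] const by (simp add: power_mult_distrib)
  qed (use bound const in \<open>auto simp: a_def v_def p_def\<close>)
  with intw that show thesis unfolding a_def by blast
qed

section \<open>From summable weighted moments to exponential rates\<close>

lemma ext_log_le_of_geometric_bound:
  assumes "1 < p" "0 \<le> a" "a \<le> (1 / p) ^ k"
  shows "ext_log (ennreal a) \<le> ereal (- (real k * ln p))"
proof (cases "a = 0")
  case False
  with assms have "0 < a" by simp
  then have "ln a \<le> ln ((1 / p) ^ k)" using assms by simp
  also have "\<dots> = - (real k * ln p)" using assms by (simp add: ln_realpow ln_div)
  finally show ?thesis using \<open>0 < a\<close> by (simp add: ext_log_def)
qed (simp add: ext_log_def)

lemma limsup_ext_log_le:
  assumes "0 < h" "1 < p" and nonneg: "\<And>k. 0 \<le> a k" and "\<forall>\<^sub>F k in sequentially. a k \<le> (1 / p) ^ k"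
  shows "limsup (\<lambda>k. ereal (1 / (real k * h)) * ext_log (ennreal (a k))) \<le> ereal (- (ln p / h))"
proof (rule Limsup_bounded)
  show "\<forall>\<^sub>F k in sequentially. ereal (1 / (real k * h)) * ext_log (ennreal (a k)) \<le> ereal (- (ln p / h))"
    using assms(4) eventually_gt_at_top[of 0]
  proof eventually_elim
    case (elim k)
    have "ereal (1 / (real k * h)) * ext_log (ennreal (a k))
        \<le> ereal (1 / (real k * h)) * ereal (- (real k * ln p))"
      using assms(1,2) nonneg elim by (intro ereal_mult_left_mono ext_log_le_of_geometric_bound) auto
    also have "\<dots> = ereal (- (ln p / h))" using elim assms(1) by simp
    finally show ?case .
  qed
qed

text \<open>By monotone convergence the sum has finite integral, hence is finite almost everywhere.
  This gives the pathwise claim directly, taking the place of a Chebyshev and Borel-Cantelli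
  argument.\<close>

lemma AE_summable_of_summable_integral:
  fixes f :: "nat \<Rightarrow> 'a \<Rightarrow> real"
  assumes "\<And>k. integrable M (f k)" "\<And>k x. 0 \<le> f k x" "summable (\<lambda>k. integral\<^sup>L M (f k))"
  shows "AE x in M. summable (\<lambda>k. f k x)"
proof -
  have "(\<integral>\<^sup>+ x. (\<Sum>k. ennreal (f k x)) \<partial>M) = (\<Sum>k. ennreal (integral\<^sup>L M (f k)))"
    using assms by (subst nn_integral_suminf) (auto simp: nn_integral_eq_integral)
  also have "\<dots> \<noteq> \<infinity>"
    using assms by (simp add: suminf_ennreal2)
  finally have "AE x in M. (\<Sum>k. ennreal (f k x)) \<noteq> \<infinity>"
    using assms(1) by (intro nn_integral_PInf_AE) auto
  then show ?thesis
    by eventually_elim (use assms(2) in \<open>auto intro!: summable_suminf_not_top\<close>)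
qed

text \<open>The terms of a convergent series are eventually below \<open>1\<close>, so the second
  moments are eventually at most \<open>(1 / q) ^ k\<close>. The weighted series of squared norms
  converges almost surely as well, and taking square roots gives the pathwise rate
  \<open>ln (sqrt q) / h\<close>.\<close>

lemma (in prob_space) exponential_stability_of_summable:
  fixes x :: "nat \<Rightarrow> 'a \<Rightarrow> 'b::{second_countable_topology, real_normed_vector}"
  assumes h: "0 < h" and q: "1 < q"
    and int: "\<And>k. integrable M (\<lambda>\<omega>. (norm (x k \<omega>))\<^sup>2)"
    and sum: "summable (\<lambda>k. q ^ k * expectation (\<lambda>\<omega>. (norm (x k \<omega>))\<^sup>2))"
  shows "limsup (\<lambda>k. ext_log (\<integral>\<^sup>+ \<omega>. ennreal ((norm (x k \<omega>))\<^sup>2) \<partial>M) / ereal (real k * h)) < 0"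
    and "\<exists>\<kappa>>0. AE \<omega> in M. limsup (\<lambda>k. ereal (1 / (real k * h)) * ext_log (ennreal (norm (x k \<omega>))))
      \<le> ereal (- \<kappa>)"
proof -
  have eventually_le: "\<forall>\<^sub>F k in sequentially. a k \<le> (1 / q) ^ k" if "summable (\<lambda>k. q ^ k * a k)" for a
  proof -
    have "\<forall>\<^sub>F k in sequentially. q ^ k * a k < 1"
      using order_tendstoD(2)[OF summable_LIMSEQ_zero[OF that]] by simp
    then show ?thesis
      by eventually_elim (use q in \<open>simp add: power_divide field_simps\<close>)
  qed
  have "limsup (\<lambda>k. ereal (1 / (real k * h)) * ext_log (ennreal (expectation (\<lambda>\<omega>. (norm (x k \<omega>))\<^sup>2))))
      \<le> ereal (- (ln q / h))"
    using h q eventually_le[OF sum] by (intro limsup_ext_log_le) auto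
  also have "(\<lambda>k. ereal (1 / (real k * h)) * ext_log (ennreal (expectation (\<lambda>\<omega>. (norm (x k \<omega>))\<^sup>2))))
      = (\<lambda>k. ext_log (\<integral>\<^sup>+ \<omega>. ennreal ((norm (x k \<omega>))\<^sup>2) \<partial>M) * ereal (1 / (real k * h)))"
    using int by (simp add: nn_integral_eq_integral mult.commute)
  finally have *: "limsup (\<lambda>k. ext_log (\<integral>\<^sup>+ \<omega>. ennreal ((norm (x k \<omega>))\<^sup>2) \<partial>M) * ereal (1 / (real k * h)))
      \<le> ereal (- (ln q / h))" .
  \<comment> \<open>Dividing by \<open>real k * h\<close> and multiplying by its real reciprocal
    agree for \<open>k > 0\<close>. At \<open>k = 0\<close> the conventions for division by zero
    differ between \<open>real\<close> and \<open>ereal\<close>, and the limsup ignores that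
    index.\<close>
  have "limsup (\<lambda>k. ext_log (\<integral>\<^sup>+ \<omega>. ennreal ((norm (x k \<omega>))\<^sup>2) \<partial>M) / ereal (real k * h))
      = limsup (\<lambda>k. ext_log (\<integral>\<^sup>+ \<omega>. ennreal ((norm (x k \<omega>))\<^sup>2) \<partial>M) * ereal (1 / (real k * h)))"
    by (intro Limsup_eq eventually_mono[OF eventually_gt_at_top[of 0]])
       (use h in \<open>simp add: divide_ereal_def divide_inverse\<close>)
  also note *
  also have "ereal (- (ln q / h)) < 0" using h q by simp
  finally show "limsup (\<lambda>k. ext_log (\<integral>\<^sup>+ \<omega>. ennreal ((norm (x k \<omega>))\<^sup>2) \<partial>M) / ereal (real k * h)) < 0" .
  have "AE \<omega> in M. summable (\<lambda>k. q ^ k * (norm (x k \<omega>))\<^sup>2)"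
    using int sum q by (intro AE_summable_of_summable_integral) auto
  then have "AE \<omega> in M. limsup (\<lambda>k. ereal (1 / (real k * h)) * ext_log (ennreal (norm (x k \<omega>))))
      \<le> ereal (- (ln (sqrt q) / h))"
  proof eventually_elim
    case (elim \<omega>)
    have "\<forall>\<^sub>F k in sequentially. norm (x k \<omega>) \<le> (1 / sqrt q) ^ k"
      using eventually_le[OF elim]
    proof eventually_elim
      case (elim k)
      have "((1 / sqrt q) ^ k)\<^sup>2 = ((1 / sqrt q)\<^sup>2) ^ k"
        by (simp only: power_mult[symmetric] mult.commute[of k])
      also have "(1 / sqrt q)\<^sup>2 = 1 / q"
        using q by (simp add: power_divide)
      finally have "(norm (x k \<omega>))\<^sup>2 \<le> ((1 / sqrt q) ^ k)\<^sup>2"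
        using elim by simp
      then show ?case by (rule power2_le_imp_le) (use q in simp)
    qed
    then show ?case using h q by (intro limsup_ext_log_le) auto
  qed
  then show "\<exists>\<kappa>>0. AE \<omega> in M. limsup (\<lambda>k. ereal (1 / (real k * h)) * ext_log (ennreal (norm (x k \<omega>))))
      \<le> ereal (- \<kappa>)"
    using h q by (intro exI[of _ "ln (sqrt q) / h"]) auto
qed

section \<open>Brownian increments and regularity of the implicit step\<close>

lemma (in prob_space) brownian_increment_moments:
  fixes B :: "real \<Rightarrow> 'a \<Rightarrow> real ^ 'm"
  assumes bm: "brownian_motion M F B" and sub: "\<And>t. 0 \<le> t \<Longrightarrow> subalgebra M (F t)"
    and st: "0 \<le> s" "s < t"
  shows "(\<lambda>\<omega>. B t \<omega> - B s \<omega>) \<in> borel_measurable M"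
    and "integrable M (\<lambda>\<omega>. (B t \<omega> - B s \<omega>) $ l)"
    and "expectation (\<lambda>\<omega>. (B t \<omega> - B s \<omega>) $ l) = 0"
    and "integrable M (\<lambda>\<omega>. (B t \<omega> - B s \<omega>) $ l * (B t \<omega> - B s \<omega>) $ l')"
    and "expectation (\<lambda>\<omega>. (B t \<omega> - B s \<omega>) $ l * (B t \<omega> - B s \<omega>) $ l') = (if l = l' then t - s else 0)"
proof -
  let ?b = "\<lambda>l \<omega>. (B t \<omega> - B s \<omega>) $ l"
  have "B u \<in> borel_measurable M" if "0 \<le> u" for u
    using bm that measurable_from_subalg[OF sub[OF that]] unfolding brownian_motion_def by blast
  from this[of t] this[of s] st
  show "(\<lambda>\<omega>. B t \<omega> - B s \<omega>) \<in> borel_measurable M"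
    by (intro borel_measurable_diff) auto
  have normal: "distributed M lborel (?b l) (normal_density 0 (sqrt (t - s)))" for l
    using bm st unfolding brownian_motion_def by blast
  have indep: "indep_vars (\<lambda>_. borel) ?b UNIV"
    using bm st unfolding brownian_motion_def by blast
  have pos: "0 < sqrt (t - s)" using st by simp
  have int: "integrable M (?b l)" for l
    using distributed_integrable[OF normal, of "\<lambda>x. x"] integrable_normal_moment_nz_1[OF pos, of 0]
    by simp
  have mean: "expectation (?b l) = 0" for l
    by (rule normal_distributed_expectation[OF pos normal])
  have int2: "integrable M (\<lambda>\<omega>. (?b l \<omega>)\<^sup>2)" for l
    using distributed_integrable[OF normal, of "\<lambda>x. x\<^sup>2"] integrable_normal_moment[OF pos, of 0 2]
    by simp
  have var: "expectation (\<lambda>\<omega>. (?b l \<omega>)\<^sup>2) = t - s" for l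
    using normal_distributed_variance[OF pos normal, of l] st unfolding mean by simp
  show "integrable M (?b l)" "expectation (?b l) = 0"
    using int mean by auto
  \<comment> \<open>Distinct components are independent, so the expectation of their product is a
    product of two zero means.\<close>
  have "integrable M (\<lambda>\<omega>. ?b l \<omega> * ?b l' \<omega>) \<and> expectation (\<lambda>\<omega>. ?b l \<omega> * ?b l' \<omega>) = 0" if "l \<noteq> l'"
  proof -
    have "indep_vars (\<lambda>_. borel) ?b {l, l'}"
      by (rule indep_vars_subset[OF indep]) auto
    from indep_vars_integrable[OF _ this int] indep_vars_lebesgue_integral[OF _ this int] that mean
    show ?thesis by simp
  qed
  with int2[of l] var[of l]
  show "integrable M (\<lambda>\<omega>. ?b l \<omega> * ?b l' \<omega>)"
    "expectation (\<lambda>\<omega>. ?b l \<omega> * ?b l' \<omega>) = (if l = l' then t - s else 0)"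
    by (cases "l = l'"; simp add: power2_eq_square)+
qed

text \<open>Every point has an open neighbourhood, a product of two balls, on which the map is
  Lipschitz. This supplies the joint continuity of the drift that
  \<open>borel_measurable_implicit\<close> requires.\<close>

lemma continuous_on_local_lipschitz:
  fixes h :: "'b::real_normed_vector \<Rightarrow> 'c::real_normed_vector \<Rightarrow> 'e::real_normed_vector"
  assumes "\<And>R. R > 0 \<Longrightarrow> \<exists>K>0. \<forall>x y x' y'. norm x \<le> R \<and> norm y \<le> R \<and> norm x' \<le> R \<and> norm y' \<le> R
    \<longrightarrow> norm (h x y - h x' y') \<le> K * (norm (x - x') + norm (y - y'))"
  shows "continuous_on UNIV (\<lambda>(x, y). h x y)"
proof (rule continuous_at_imp_continuous_on, rule ballI)
  fix p :: "'b \<times> 'c"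
  \<comment> \<open>The summand \<open>1\<close> makes \<open>R\<close> positive and puts both
    components of \<open>p\<close> strictly inside the ball of radius \<open>R\<close>.\<close>
  define R where "R = norm (fst p) + norm (snd p) + 1"
  define S :: "('b \<times> 'c) set" where "S = ball 0 R \<times> ball 0 R"
  have "R > 0" unfolding R_def by (simp add: add_nonneg_pos)
  from assms[OF this] obtain K where K: "K > 0" "\<And>x y x' y'. norm x \<le> R \<Longrightarrow> norm y \<le> R \<Longrightarrow>
      norm x' \<le> R \<Longrightarrow> norm y' \<le> R \<Longrightarrow> norm (h x y - h x' y') \<le> K * (norm (x - x') + norm (y - y'))"
    by blast
  have "(2 * K)-lipschitz_on S (\<lambda>(x, y). h x y)"
  proof (rule lipschitz_onI)
    fix u v assume uv: "u \<in> S" "v \<in> S"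
    have "dist (case u of (x, y) \<Rightarrow> h x y) (case v of (x, y) \<Rightarrow> h x y)
        \<le> K * (dist (fst u) (fst v) + dist (snd u) (snd v))"
      using K(2)[of "fst u" "snd u" "fst v" "snd v"] uv unfolding S_def
      by (auto simp: dist_norm case_prod_beta mem_Times_iff)
    also have "\<dots> \<le> K * (dist u v + dist u v)"
      using K(1) by (intro mult_left_mono add_mono dist_fst_le dist_snd_le) auto
    finally show "dist (case u of (x, y) \<Rightarrow> h x y) (case v of (x, y) \<Rightarrow> h x y) \<le> 2 * K * dist u v"
      by simp
  qed (use K in simp)
  then have "continuous_on S (\<lambda>(x, y). h x y)"
    by (rule lipschitz_on_continuous_on)
  moreover have "open S" "p \<in> S"
    unfolding S_def R_def by (auto simp: open_Times mem_Times_iff add_pos_nonneg add.commute)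
  ultimately show "isCont (\<lambda>(x, y). h x y) p"
    by (simp add: continuous_on_eq_continuous_at)
qed

text \<open>For two points with equal image, \<open>x - y\<close> is \<open>c\<close> times the
  difference of the values of \<open>h\<close>. Pairing this with \<open>x - y\<close> bounds the
  squared distance by \<open>L * c\<close> times itself, and \<open>L * c < 1\<close> forces it to
  vanish. This is the uniqueness part of the well-definedness of the scheme.\<close>

lemma inj_implicit_step:
  fixes h :: "'b::real_inner \<Rightarrow> 'b"
  assumes "\<And>x y. (x - y) \<bullet> (h x - h y) \<le> L * (norm (x - y))\<^sup>2" "0 \<le> c" "L * c < 1"
  shows "inj (\<lambda>x. x - c *\<^sub>R h x)"
proof (rule injI)
  fix x y assume "x - c *\<^sub>R h x = y - c *\<^sub>R h y"
  then have "x - y = c *\<^sub>R (h x - h y)" by (simp add: algebra_simps)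
  then have "(norm (x - y))\<^sup>2 = c * ((x - y) \<bullet> (h x - h y))"
    unfolding power2_norm_eq_inner by (metis inner_scaleR_right)
  also have "\<dots> \<le> c * (L * (norm (x - y))\<^sup>2)"
    using assms(1,2) by (rule mult_left_mono)
  finally have "(1 - L * c) * (norm (x - y))\<^sup>2 \<le> 0" by (simp add: algebra_simps)
  with assms(3) have "(norm (x - y))\<^sup>2 \<le> 0" by (simp add: mult_le_0_iff)
  then show "x = y" by simp
qed

lemma measurable_coefficient:
  assumes c: "(\<lambda>(x, y, t, i). c x y t i) \<in> borel_measurable
        (borel \<Otimes>\<^sub>M borel \<Otimes>\<^sub>M restrict_space borel {0..} \<Otimes>\<^sub>M count_space I)"
    and "u \<in> borel_measurable A" "v \<in> borel_measurable A" "\<rho> \<in> A \<rightarrow>\<^sub>M count_space I" "0 \<le> (t::real)"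
  shows "(\<lambda>\<omega>. c (u \<omega>) (v \<omega>) t (\<rho> \<omega>)) \<in> borel_measurable A"
proof -
  have "(\<lambda>\<omega>. (u \<omega>, v \<omega>, t, \<rho> \<omega>)) \<in> A \<rightarrow>\<^sub>M
      borel \<Otimes>\<^sub>M borel \<Otimes>\<^sub>M restrict_space borel {0..} \<Otimes>\<^sub>M count_space I"
    using assms by (intro measurable_Pair measurable_const) auto
  from measurable_compose[OF this c] show ?thesis by simp
qed

section \<open>Adaptedness of the scheme\<close>

lemma filtration_measurable_mono:
  assumes "complete_filtration M F" "0 \<le> s" "s \<le> t" "u \<in> F s \<rightarrow>\<^sub>M K"
  shows "u \<in> F t \<rightarrow>\<^sub>M K"
proof (rule measurable_from_subalg[OF _ assms(4)])
  show "subalgebra (F t) (F s)"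
    using assms by (auto simp: complete_filtration_def subalgebra_def)
qed

text \<open>
  Below, \<open>X\<close> is reindexed from \<open>0\<close>: \<open>w k = X (k - n)\<close>, so that \<open>w (k + n) = X k\<close> and the
  delayed value at step \<open>k\<close> is \<open>w k\<close>.
\<close>

lemma theta_EM_step:
  assumes "theta_EM M D f g r B \<xi> \<theta> n \<Delta> X" "\<omega> \<in> space M"
  defines "w \<equiv> \<lambda>k. X (int k - int n) \<omega>" and "\<rho> \<equiv> \<lambda>k. r (real k * \<Delta>) \<omega>"
  shows "w (Suc k + n) - D (w (Suc k)) (\<rho> (Suc k))
    = w (k + n) - D (w k) (\<rho> k)
      + \<Delta> *\<^sub>R ((1 - \<theta>) *\<^sub>R f (w (k + n)) (w k) (real k * \<Delta>) (\<rho> k)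
           + \<theta> *\<^sub>R f (w (Suc k + n)) (w (Suc k)) (real (Suc k) * \<Delta>) (\<rho> (Suc k)))
      + g (w (k + n)) (w k) (real k * \<Delta>) (\<rho> k) *v (B (real (Suc k) * \<Delta>) \<omega> - B (real k * \<Delta>) \<omega>)"
proof -
  have idx: "int (Suc k + n) - int n = int k + 1" "int (k + n) - int n = int k"
    "int (Suc k) - int n = int k + 1 - int n"
    "real (Suc k) = of_int (int k + 1)" "real k = of_int (int k)"
    by simp_all
  show ?thesis
    using assms(1,2) unfolding theta_EM_def w_def \<rho>_def idx Let_def by (meson of_nat_0_le_iff)
qed

text \<open>\<open>theta_EM\<close> only states pointwise equations, so measurability must be
  derived. Each new value is the only solution of an implicit equation whose data are already
  measurable, and \<open>borel_measurable_implicit\<close> applies.\<close>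

lemma theta_EM_adapted:
  fixes f :: "real ^ 'd \<Rightarrow> real ^ 'd \<Rightarrow> real \<Rightarrow> nat \<Rightarrow> real ^ 'd"
    and g :: "real ^ 'd \<Rightarrow> real ^ 'd \<Rightarrow> real \<Rightarrow> nat \<Rightarrow> real ^ 'm ^ 'd"
  assumes filt: "complete_filtration M F"
    and r: "\<And>t. 0 \<le> t \<Longrightarrow> r t \<in> F t \<rightarrow>\<^sub>M count_space {1..N}"
    and B: "\<And>t. 0 \<le> t \<Longrightarrow> B t \<in> borel_measurable (F t)"
    and \<xi>: "\<And>s. s \<in> {- (real n * \<Delta>)..0} \<Longrightarrow> \<xi> s \<in> borel_measurable (F 0)"
    and D: "(\<lambda>(x, i). D x i) \<in> borel_measurable (borel \<Otimes>\<^sub>M count_space {1..N})"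
    and f: "(\<lambda>(x, y, t, i). f x y t i) \<in> borel_measurable
        (borel \<Otimes>\<^sub>M borel \<Otimes>\<^sub>M restrict_space borel {0..} \<Otimes>\<^sub>M count_space {1..N})"
    and g: "(\<lambda>(x, y, t, i). g x y t i) \<in> borel_measurable
        (borel \<Otimes>\<^sub>M borel \<Otimes>\<^sub>M restrict_space borel {0..} \<Otimes>\<^sub>M count_space {1..N})"
    and cont: "\<And>t i. 0 \<le> t \<Longrightarrow> i \<in> {1..N} \<Longrightarrow> continuous_on UNIV (\<lambda>(x, y). f x y t i)"
    and inj: "\<And>t i y. 0 \<le> t \<Longrightarrow> i \<in> {1..N} \<Longrightarrow> inj (\<lambda>x. x - (\<theta> * \<Delta>) *\<^sub>R f x y t i)"
    and n: "1 \<le> n" and \<Delta>: "0 < \<Delta>"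
    and scheme: "theta_EM M D f g r B \<xi> \<theta> n \<Delta> X"
  shows "X (int k - int n) \<in> borel_measurable (F (real (k - n) * \<Delta>))"
proof (induction k rule: less_induct)
  case (less k)
  have space: "space (F t) = space M" if "0 \<le> t" for t
    using filt that by (simp add: complete_filtration_def subalgebra_def)
  show ?case
  proof (cases "k \<le> n")
    case True
    \<comment> \<open>Truncated subtraction gives \<open>k - n = 0\<close> in this case, so the
      claim concerns \<open>F 0\<close>, where the initial datum is measurable.\<close>
    have "of_int (int k - int n) * \<Delta> = - (real (n - k) * \<Delta>)"
      using True by (simp add: of_nat_diff algebra_simps)
    moreover have "real (n - k) * \<Delta> \<le> real n * \<Delta>" "0 \<le> real (n - k) * \<Delta>"
      using \<Delta> by (auto intro!: mult_right_mono)
    ultimately have "\<xi> (of_int (int k - int n) * \<Delta>) \<in> borel_measurable (F 0)"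
      by (intro \<xi>) simp
    moreover have "X (int k - int n) \<omega> = \<xi> (of_int (int k - int n) * \<Delta>) \<omega>" if "\<omega> \<in> space (F 0)" for \<omega>
      using scheme that True unfolding theta_EM_def space[OF order_refl] by auto
    ultimately have "X (int k - int n) \<in> borel_measurable (F 0)"
      by (subst measurable_cong) auto
    then show ?thesis using True by simp
  next
    case False
    then obtain j where k: "k = Suc j + n"
      by (metis add.commute less_imp_Suc_add not_le add_Suc_right)
    define t where "t = real j * \<Delta>"
    define t' where "t' = real (Suc j) * \<Delta>"
    have t: "0 \<le> t" "0 \<le> t'" "t \<le> t'"
      unfolding t_def t'_def using \<Delta> by (auto intro!: mult_right_mono)
    define w where "w i = X (int i - int n)" for i
    have wF: "w i \<in> borel_measurable (F t')" if "i < k" for i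
      unfolding w_def t'_def
      by (rule filtration_measurable_mono[OF filt _ _ less.IH[OF that]])
         (use that \<Delta> k in \<open>auto intro!: mult_right_mono\<close>)
    have rF: "r t \<in> F t' \<rightarrow>\<^sub>M count_space {1..N}" "r t' \<in> F t' \<rightarrow>\<^sub>M count_space {1..N}"
      using filtration_measurable_mono[OF filt t(1,3) r] r t by auto
    have BF: "(\<lambda>\<omega>. B t' \<omega> - B t \<omega>) \<in> borel_measurable (F t')"
      using filtration_measurable_mono[OF filt t(1,3) B] B t by (intro borel_measurable_diff) auto
    have w: "w (j + n) \<in> borel_measurable (F t')" "w j \<in> borel_measurable (F t')"
      "w (Suc j) \<in> borel_measurable (F t')"
      using n k by (auto intro!: wF)
    have Dw: "(\<lambda>\<omega>. D (w i \<omega>) (r s \<omega>)) \<in> borel_measurable (F t')"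
      if "w i \<in> borel_measurable (F t')" "r s \<in> F t' \<rightarrow>\<^sub>M count_space {1..N}" for i s
      using measurable_compose[OF measurable_Pair[OF that] D] by simp
    note coeff = measurable_coefficient[OF _ w(1,2) rF(1) t(1)]
    \<comment> \<open>\<open>u\<close> collects everything except the implicit drift. The neutral
      term at the new time belongs to it because its argument \<open>w (Suc j)\<close> has index
      below \<open>k = Suc j + n\<close>, by \<open>1 \<le> n\<close>.\<close>
    define u where "u \<omega> = w (j + n) \<omega> - D (w j \<omega>) (r t \<omega>) + D (w (Suc j) \<omega>) (r t' \<omega>)
      + (\<Delta> * (1 - \<theta>)) *\<^sub>R f (w (j + n) \<omega>) (w j \<omega>) t (r t \<omega>)
      + g (w (j + n) \<omega>) (w j \<omega>) t (r t \<omega>) *v (B t' \<omega> - B t \<omega>)" for \<omega>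
    have "(\<lambda>\<omega>. g (w (j + n) \<omega>) (w j \<omega>) t (r t \<omega>) *v (B t' \<omega> - B t \<omega>)) \<in> borel_measurable (F t')"
    proof -
      have "continuous_on UNIV (\<lambda>(A :: real ^ 'm ^ 'd, b). A *v b)"
        unfolding matrix_vector_mult_def case_prod_beta
        by (intro continuous_intros continuous_on_vec_lambda)
      from measurable_compose[OF measurable_Pair[OF coeff[OF g] BF, unfolded borel_prod]
          borel_measurable_continuous_onI[OF this]]
      show ?thesis by simp
    qed
    then have u: "u \<in> borel_measurable (F t')"
      unfolding u_def using w(1) Dw[OF w(2) rF(1)] Dw[OF w(3) rF(2)] coeff[OF f]
      by (intro borel_measurable_add borel_measurable_diff borel_measurable_scaleR) auto
    have "w k \<in> borel_measurable (F t')"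
    proof (rule borel_measurable_implicit[where \<phi> = "\<lambda>i x y. x - (\<theta> * \<Delta>) *\<^sub>R f x y t' i"])
      show "continuous_on UNIV (\<lambda>(x, y). x - (\<theta> * \<Delta>) *\<^sub>R f x y t' i)" if "i \<in> {1..N}" for i
        using cont[OF t(2) that] unfolding case_prod_beta by (intro continuous_intros)
      show "inj (\<lambda>x. x - (\<theta> * \<Delta>) *\<^sub>R f x y t' i)" if "i \<in> {1..N}" for i y
        by (rule inj[OF t(2) that])
      show "w k \<omega> - (\<theta> * \<Delta>) *\<^sub>R f (w k \<omega>) (w (Suc j) \<omega>) t' (r t' \<omega>) = u \<omega>"
        if "\<omega> \<in> space (F t')" for \<omega>
        using theta_EM_step[OF scheme, of \<omega> j] that
        unfolding u_def w_def t_def[symmetric] t'_def[symmetric] k space[OF t(2)]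
        by (simp add: algebra_simps)
    qed (use u w rF in auto)
    then show ?thesis unfolding w_def t'_def k by simp
  qed
qed

section \<open>Stability of the scheme from the energy estimate\<close>

theorem theorem5p1:
  fixes M :: "'a measure"
    and F :: "real \<Rightarrow> 'a measure"
    and N n :: nat
    and \<Gamma> :: "nat \<Rightarrow> nat \<Rightarrow> real"
    and r :: "real \<Rightarrow> 'a \<Rightarrow> nat"
    and i\<^sub>0 :: nat
    and B :: "real \<Rightarrow> 'a \<Rightarrow> real ^ 'm"
    and \<xi> :: "real \<Rightarrow> 'a \<Rightarrow> real ^ 'd"
    and D :: "real ^ 'd \<Rightarrow> nat \<Rightarrow> real ^ 'd"
    and f :: "real ^ 'd \<Rightarrow> real ^ 'd \<Rightarrow> real \<Rightarrow> nat \<Rightarrow> real ^ 'd"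
    and g :: "real ^ 'd \<Rightarrow> real ^ 'd \<Rightarrow> real \<Rightarrow> nat \<Rightarrow> real ^ 'm ^ 'd"
    and X :: "int \<Rightarrow> 'a \<Rightarrow> real ^ 'd"
    and \<tau> \<beta> L C\<^sub>1 C\<^sub>2 \<theta> \<Delta> :: real
  assumes prob: "prob_space M"
    and filt: "complete_filtration M F"
    and tau: "\<tau> > 0"
    and gen: "generator_matrix N \<Gamma>"
    and chain: "markov_chain M F N \<Gamma> r"
    and bm: "brownian_motion M F B"
    and indep: "independent_processes M N B r"
    and init: "initial_datum M F \<tau> \<xi>"
    and i0: "i\<^sub>0 \<in> {1..N}"
    and r0: "AE \<omega> in M. r 0 \<omega> = i\<^sub>0"
    and D_meas: "(\<lambda>(x, i). D x i) \<in> borel_measurable (borel \<Otimes>\<^sub>M count_space {1..N})"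
    and f_meas: "(\<lambda>(x, y, t, i). f x y t i) \<in> borel_measurable
        (borel \<Otimes>\<^sub>M borel \<Otimes>\<^sub>M restrict_space borel {0..} \<Otimes>\<^sub>M count_space {1..N})"
    and g_meas: "(\<lambda>(x, y, t, i). g x y t i) \<in> borel_measurable
        (borel \<Otimes>\<^sub>M borel \<Otimes>\<^sub>M restrict_space borel {0..} \<Otimes>\<^sub>M count_space {1..N})"
    and local_lipschitz: "\<forall>R>0. \<exists>L\<^sub>R>0. \<forall>t\<ge>0. \<forall>i\<in>{1..N}. \<forall>x y x' y'.
        norm x \<le> R \<and> norm y \<le> R \<and> norm x' \<le> R \<and> norm y' \<le> R \<longrightarrow>
        max (norm (f x y t i - f x' y' t i)) (norm (g x y t i - g x' y' t i))
          \<le> L\<^sub>R * (norm (x - x') + norm (y - y'))"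
    and beta: "0 < \<beta>" "\<beta> < 1"
    and D_contr: "\<forall>x y. \<forall>i\<in>{1..N}. norm (D x i - D y i) \<le> \<beta> * norm (x - y)"
    and zero: "\<forall>t\<ge>0. \<forall>i\<in>{1..N}. D 0 i = 0 \<and> f 0 0 t i = 0 \<and> g 0 0 t i = 0"
    and beta_sq: "\<beta>\<^sup>2 < 1 / (3 + 2 * sqrt 2)"
    and L_pos: "L > 0"
    and one_sided: "\<forall>x\<^sub>1 x\<^sub>2 y. \<forall>t\<ge>0. \<forall>i\<in>{1..N}.
        (x\<^sub>1 - x\<^sub>2) \<bullet> (f x\<^sub>1 y t i - f x\<^sub>2 y t i) \<le> L * (norm (x\<^sub>1 - x\<^sub>2))\<^sup>2"
    and C: "C\<^sub>1 > C\<^sub>2" "C\<^sub>2 > 0"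
    and C_ratio: "C\<^sub>1 > (3 + 2 * sqrt 2) / (1 - (3 + 2 * sqrt 2) * \<beta>\<^sup>2) * C\<^sub>2"
    and dissip: "\<forall>x y. \<forall>t\<ge>0. \<forall>i\<in>{1..N}.
        2 * ((x - D y i) \<bullet> f x y t i) + (norm (g x y t i))\<^sup>2
          \<le> - C\<^sub>1 * (norm x)\<^sup>2 + C\<^sub>2 * (norm y)\<^sup>2"
    and theta: "1 / 2 < \<theta>" "\<theta> \<le> 1"
    and n: "n \<ge> 1"
    and step: "\<Delta> = \<tau> / real n" "L * \<theta> * \<Delta> < 1"
    and scheme: "theta_EM M D f g r B \<xi> \<theta> n \<Delta> X"
  shows "limsup (\<lambda>k::nat. ext_log (\<integral>\<^sup>+ \<omega>. ennreal ((norm (X (int k) \<omega>))\<^sup>2) \<partial>M)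
            / ereal (real k * \<Delta>)) < 0
       \<and> (\<exists>\<kappa>>0. AE \<omega> in M.
            limsup (\<lambda>k::nat. ereal (1 / (real k * \<Delta>)) * ext_log (ennreal (norm (X (int k) \<omega>))))
              \<le> ereal (- \<kappa>))"
proof -
  interpret prob_space M by (rule prob)
  define w where "w k = X (int k - int n)" for k
  define t where "t k = real k * \<Delta>" for k
  define Y where "Y k \<omega> = w (k + n) \<omega> - D (w k \<omega>) (r (t k) \<omega>)" for k \<omega>
  define \<phi> where "\<phi> k \<omega> = f (w (k + n) \<omega>) (w k \<omega>) (t k) (r (t k) \<omega>)" for k \<omega>
  define G where "G k \<omega> = g (w (k + n) \<omega>) (w k \<omega>) (t k) (r (t k) \<omega>)" for k \<omega>
  define b where "b k \<omega> = B (t (Suc k)) \<omega> - B (t k) \<omega>" for k \<omega>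
  have \<Delta>: "0 < \<Delta>" and n\<Delta>: "real n * \<Delta> = \<tau>" using tau n step(1) by auto
  have t: "0 \<le> t k" "t k < t (Suc k)" "t (Suc k) - t k = \<Delta>" for k
    unfolding t_def using \<Delta> by (auto simp: algebra_simps)
  have sub: "subalgebra M (F s)" if "0 \<le> s" for s
    using filt that by (simp add: complete_filtration_def)
  have rF: "r s \<in> F s \<rightarrow>\<^sub>M count_space {1..N}" if "0 \<le> s" for s
    using chain that by (simp add: markov_chain_def)
  have rM: "r s \<omega> \<in> {1..N}" if "0 \<le> s" "\<omega> \<in> space M" for s \<omega>
    using measurable_space[OF rF[OF that(1)], of \<omega>] sub[OF that(1)] that(2) by (simp add: subalgebra_def)
  have f_lip: "\<exists>K>0. \<forall>t\<ge>0. \<forall>i\<in>{1..N}. \<forall>x y x' y'.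
      norm x \<le> R \<and> norm y \<le> R \<and> norm x' \<le> R \<and> norm y' \<le> R \<longrightarrow>
      norm (f x y t i - f x' y' t i) \<le> K * (norm (x - x') + norm (y - y'))" if "R > 0" for R
    using local_lipschitz[rule_format, OF that] unfolding max.bounded_iff by blast
  have adapted: "w k \<in> borel_measurable (F (real (k - n) * \<Delta>))" for k
    unfolding w_def
  proof (rule theta_EM_adapted[OF filt rF _ _ D_meas f_meas g_meas _ _ n \<Delta> scheme])
    show "B s \<in> borel_measurable (F s)" if "0 \<le> s" for s
      using bm that by (simp add: brownian_motion_def)
    show "\<xi> s \<in> borel_measurable (F 0)" if "s \<in> {- (real n * \<Delta>)..0}" for s
      using init that unfolding n\<Delta> initial_datum_def by blast
    show "continuous_on UNIV (\<lambda>(x, y). f x y s i)" if "0 \<le> s" "i \<in> {1..N}" for s i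
    proof (rule continuous_on_local_lipschitz)
      fix R :: real assume "R > 0"
      from f_lip[OF this] obtain K where "K > 0" "\<forall>t\<ge>0. \<forall>i\<in>{1..N}. \<forall>x y x' y'.
          norm x \<le> R \<and> norm y \<le> R \<and> norm x' \<le> R \<and> norm y' \<le> R \<longrightarrow>
          norm (f x y t i - f x' y' t i) \<le> K * (norm (x - x') + norm (y - y'))"
        by blast
      with that show "\<exists>K>0. \<forall>x y x' y'. norm x \<le> R \<and> norm y \<le> R \<and> norm x' \<le> R \<and> norm y' \<le> R \<longrightarrow>
          norm (f x y s i - f x' y' s i) \<le> K * (norm (x - x') + norm (y - y'))"
        by (intro exI[of _ K]) simp
    qed
    show "inj (\<lambda>x. x - (\<theta> * \<Delta>) *\<^sub>R f x y s i)" if "0 \<le> s" "i \<in> {1..N}" for s i y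
      using one_sided that step(2) theta \<Delta>
      by (intro inj_implicit_step[where L = L]) (auto simp: mult.assoc)
  qed
  \<comment> \<open>The current value has time index exactly \<open>k\<close>. For the delayed value
    the index is the truncated \<open>k - n\<close>, and monotonicity of the filtration lifts it to
    \<open>t k\<close>.\<close>
  have wF: "w (k + n) \<in> borel_measurable (F (t k))" "w k \<in> borel_measurable (F (t k))" for k
    using adapted[of "k + n"] filtration_measurable_mono[OF filt _ _ adapted, of k "t k"] \<Delta>
    by (auto simp: t_def mult_right_mono)
  have wM: "w k \<in> borel_measurable M" for k
    by (rule measurable_from_subalg[OF sub[OF t(1)] wF(2)])
  have YF: "Y k \<in> borel_measurable (F (t k))" for k
    unfolding Y_def
    using measurable_compose[OF measurable_Pair[OF wF(2) rF[OF t(1)]] D_meas] wF(1)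
    by (intro borel_measurable_diff) auto
  have \<phi>F: "\<phi> k \<in> borel_measurable (F (t k))" and GF: "G k \<in> borel_measurable (F (t k))" for k
    unfolding \<phi>_def G_def
    by (rule measurable_coefficient[OF f_meas wF rF[OF t(1)] t(1)],
        rule measurable_coefficient[OF g_meas wF rF[OF t(1)] t(1)])
  have D_bound: "norm (D x i) \<le> \<beta> * norm x" if "i \<in> {1..N}" for x i
    using D_contr[rule_format, OF that, of x 0] zero that by auto
  have Y_bound: "norm (Y k \<omega>) \<le> norm (w (k + n) \<omega>) + \<beta> * norm (w k \<omega>)" if "\<omega> \<in> space M" for k \<omega>
    unfolding Y_def
    by (rule order_trans[OF norm_triangle_ineq4 add_left_mono[OF D_bound[OF rM[OF t(1) that]]]])
  obtain K where K: "K > 0" "AE \<omega> in M. \<forall>k\<le>n. norm (w k \<omega>) \<le> K"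
  proof -
    obtain K where K: "AE \<omega> in M. \<forall>s\<in>{-\<tau>..0}. norm (\<xi> s \<omega>) \<le> K"
      using init unfolding initial_datum_def by blast
    \<comment> \<open>The maximum with \<open>1\<close> makes the bound positive, so that it can
      serve as the radius in \<open>f_lip\<close>.\<close>
    have "AE \<omega> in M. \<forall>k\<le>n. norm (w k \<omega>) \<le> max K 1"
      using K AE_space
    proof eventually_elim
      case (elim \<omega>)
      have "norm (w k \<omega>) \<le> K" if "k \<le> n" for k
      proof -
        have "real k * \<Delta> \<le> real n * \<Delta>" "0 \<le> real k * \<Delta>"
          using that \<Delta> by (auto intro!: mult_right_mono)
        then have "of_int (int k - int n) * \<Delta> \<in> {-\<tau>..0}"
          unfolding n\<Delta>[symmetric] by (simp add: algebra_simps)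
        moreover have "w k \<omega> = \<xi> (of_int (int k - int n) * \<Delta>) \<omega>"
          using scheme elim(2) that unfolding theta_EM_def w_def by auto
        ultimately show ?thesis using elim(1) by simp
      qed
      then show ?case by fastforce
    qed
    then show thesis by (intro that[of "max K 1"]) auto
  qed
  have start: "integrable M (\<lambda>\<omega>. (norm (w k \<omega>))\<^sup>2)" if "k < n" for k
  proof (rule integrable_const_bound)
    show "AE \<omega> in M. norm ((norm (w k \<omega>))\<^sup>2) \<le> K\<^sup>2"
      using K(2) by eventually_elim (use that in \<open>auto intro!: power_mono\<close>)
  qed (use wM in measurable)
  have start': "integrable M (\<lambda>\<omega>. (norm (Y 0 \<omega> - (\<theta> * \<Delta>) *\<^sub>R \<phi> 0 \<omega>))\<^sup>2)"
  proof -
    \<comment> \<open>Comparison with the origin, where \<open>f\<close> vanishes, turns the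
      Lipschitz bound on the ball of radius \<open>K\<close> into a bound for the initial drift
      \<open>\<phi> 0\<close>. Boundedness of the initial datum thus gives a square integrable
      \<open>Z 0\<close>.\<close>
    obtain K' where K': "K' > 0" "\<And>s i x y. 0 \<le> s \<Longrightarrow> i \<in> {1..N} \<Longrightarrow> norm x \<le> K \<Longrightarrow> norm y \<le> K \<Longrightarrow>
        norm (f x y s i - f 0 0 s i) \<le> K' * (norm (x - 0) + norm (y - 0))"
    proof -
      obtain K' where "K' > 0" and K': "\<forall>t\<ge>0. \<forall>i\<in>{1..N}. \<forall>x y x' y'.
          norm x \<le> K \<and> norm y \<le> K \<and> norm x' \<le> K \<and> norm y' \<le> K \<longrightarrow>
          norm (f x y t i - f x' y' t i) \<le> K' * (norm (x - x') + norm (y - y'))"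
        using f_lip[OF K(1)] by blast
      show thesis
        by (rule that[OF \<open>K' > 0\<close>], rule K'[rule_format]) (use K(1) in auto)
    qed
    show ?thesis
    proof (rule integrable_const_bound)
      show "AE \<omega> in M. norm ((norm (Y 0 \<omega> - (\<theta> * \<Delta>) *\<^sub>R \<phi> 0 \<omega>))\<^sup>2)
          \<le> (K + \<beta> * K + \<theta> * \<Delta> * (K' * (K + K)))\<^sup>2"
        using K(2) AE_space
      proof eventually_elim
        case (elim \<omega>)
        then have wK: "norm (w (0 + n) \<omega>) \<le> K" "norm (w 0 \<omega>) \<le> K" by auto
        have "norm (Y 0 \<omega>) \<le> K + \<beta> * K"
          using Y_bound[OF elim(2), of 0] wK beta mult_left_mono[OF wK(2), of \<beta>] by linarith
        moreover have "norm (\<phi> 0 \<omega>) \<le> K' * (K + K)"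
        proof -
          have "norm (\<phi> 0 \<omega>) \<le> K' * (norm (w (0 + n) \<omega>) + norm (w 0 \<omega>))"
            using K'(2)[OF t(1) rM[OF t(1) elim(2)] wK, of 0 0] zero rM[OF t(1) elim(2), of 0] t(1)[of 0]
            unfolding \<phi>_def by simp
          also have "\<dots> \<le> K' * (K + K)"
            using wK K'(1) by (intro mult_left_mono add_mono) auto
          finally show ?thesis .
        qed
        then have "norm ((\<theta> * \<Delta>) *\<^sub>R \<phi> 0 \<omega>) \<le> \<theta> * \<Delta> * (K' * (K + K))"
          using theta \<Delta> by (simp add: mult_left_mono)
        ultimately have "norm (Y 0 \<omega> - (\<theta> * \<Delta>) *\<^sub>R \<phi> 0 \<omega>) \<le> K + \<beta> * K + \<theta> * \<Delta> * (K' * (K + K))"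
          using norm_triangle_ineq4[of "Y 0 \<omega>" "(\<theta> * \<Delta>) *\<^sub>R \<phi> 0 \<omega>"] by linarith
        then show ?case by (simp add: power_mono)
      qed
      have "(\<lambda>\<omega>. Y 0 \<omega> - (\<theta> * \<Delta>) *\<^sub>R \<phi> 0 \<omega>) \<in> borel_measurable M"
        using measurable_from_subalg[OF sub[OF t(1)] YF] measurable_from_subalg[OF sub[OF t(1)] \<phi>F]
        by (intro borel_measurable_diff borel_measurable_scaleR) auto
      then show "(\<lambda>\<omega>. (norm (Y 0 \<omega> - (\<theta> * \<Delta>) *\<^sub>R \<phi> 0 \<omega>))\<^sup>2) \<in> borel_measurable M"
        by measurable
    qed
  qed
  note increment = brownian_increment_moments[OF bm sub t(1,2), folded b_def, unfolded t(3)]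
  obtain q where q: "q > 1" "\<And>k. integrable M (\<lambda>\<omega>. (norm (w k \<omega>))\<^sup>2)"
    "summable (\<lambda>k. q ^ k * expectation (\<lambda>\<omega>. (norm (w (k + n) \<omega>))\<^sup>2))"
  proof (rule split_step_summable[of "\<lambda>k. F (t k)" w Y \<phi> G b \<Delta> n \<theta> C\<^sub>1 C\<^sub>2 \<beta>])
    show "subalgebra M (F (t k))" for k by (rule sub[OF t(1)])
    show "indep_set (sets (F (t k))) {b k -` S \<inter> space M |S. S \<in> sets borel}" for k
      unfolding b_def using bm t unfolding brownian_motion_def by blast
    \<comment> \<open>Moving the implicit drift to the left makes the step explicit: on the right,
      \<open>(1 - \<theta>) * \<Delta>\<close> splits into \<open>\<Delta>\<close>, for the new
      drift term, and \<open>- \<theta> * \<Delta>\<close>, which belongs to the old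
      \<open>Z\<close>.\<close>
    show "Y (Suc k) \<omega> - (\<theta> * \<Delta>) *\<^sub>R \<phi> (Suc k) \<omega>
        = Y k \<omega> - (\<theta> * \<Delta>) *\<^sub>R \<phi> k \<omega> + \<Delta> *\<^sub>R \<phi> k \<omega> + G k \<omega> *v b k \<omega>" if "\<omega> \<in> space M" for k \<omega>
      using theta_EM_step[OF scheme that, of k]
      unfolding Y_def \<phi>_def G_def b_def w_def t_def by (simp add: algebra_simps)
    show "2 * (Y k \<omega> \<bullet> \<phi> k \<omega>) + (norm (G k \<omega>))\<^sup>2
        \<le> - C\<^sub>1 * (norm (w (k + n) \<omega>))\<^sup>2 + C\<^sub>2 * (norm (w k \<omega>))\<^sup>2" if "\<omega> \<in> space M" for k \<omega>
      unfolding Y_def \<phi>_def G_def using dissip t(1) rM[OF t(1) that] by blast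
    show "1 / 2 < \<theta>" "0 \<le> C\<^sub>2" "C\<^sub>2 < C\<^sub>1" "1 \<le> n" "0 < \<Delta>"
      using theta C n \<Delta> by auto
  qed (assumption | rule wM YF \<phi>F GF start start' Y_bound increment that)+
  show ?thesis
    \<comment> \<open>The shift by \<open>n\<close> undoes the reindexing, since
      \<open>w (k + n)\<close> is \<open>X (int k)\<close>.\<close>
    using exponential_stability_of_summable[OF \<Delta> q(1) q(2)[of "_ + n"] q(3)]
    by (simp add: w_def)
qed

end
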